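(* Let $\beta>1$ and consider the three-block model with block sizes $|B_1|=|B_3|=\frac{N-b_N}{2}$, $|B_2|=b_N$, inter-block interaction strength $\alpha_N>0$ with $\alpha_N\downarrow0$, Gibbs measure $\mu_{N,\beta,\alpha_N}$ and magnetization vector $m=(m_1,m_2,m_3)$. As $N\to\infty$ the following hold. (1) If $\lim_{N\to\infty}\alpha_N\sqrt{N/b_N}=\infty$, then the distribution of $m$ under the Gibbs measure converges weakly to $$\frac12\left(\delta_{(m^*,1,m^* )}+\delta_{(-m^*,-1,-m^* )}\right).$$ (2) If $\lim_{N\to\infty}\alpha_N\sqrt{N/b_N}=0$ but $\lim_{N\to\infty}\alpha_N\sqrt{b_NN}=\infty$, then the distribution of $m$ under the Gibbs measure converges weakly to $$\frac12\left(\delta_{(m^*,m^*,m^* )}+\delta_{(-m^*,-m^*,-m^* )}\right).$$ (3) If $\lim_{N\to\infty}\alpha_N\sqrt{b_NN}=0$, then the distribution of $m$ under the Gibbs measure converges weakly to $$\frac18\sum_{\chi_1,\chi_2,\chi_3\in\{-1,+1\}}\delta_{(\chi_1m^*,\chi_2m^*,\chi_3m^* )}.$$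
   Context: Let $(b_N)_N\subset\mathbb N$ be a non-decreasing sequence with $b_N\to\infty$ and $b_N/N\to0$; $N$ tends to infinity along those values for which $N-b_N$ is even. The set $\{1,\dots,N\}$ is partitioned into blocks $B_1,B_2,B_3$ with $|B_2|=b_N$ and $|B_1|=|B_3|=\frac{N-b_N}{2}$. For $\sigma\in\{-1,+1\}^N$ let $m_k=\frac1{|B_k|}\sum_{i\in B_k}\sigma_i$ and $$H_{N,\beta,\alpha_N}(\sigma)=-\sum_{k=1}^3\frac{\beta}{2}|B_k|m_k^2-\alpha_N\sqrt{|B_1||B_2|}\,m_1m_2-\alpha_N\sqrt{|B_3||B_2|}\,m_3m_2 .$$ The Gibbs measure on $\{-1,+1\}^N$ is $\mu_{N,\beta,\alpha_N}(\sigma)=\frac1{Z_{N,\beta,\alpha_N}}e^{-H_{N,\beta,\alpha_N}(\sigma)}2^{-N}$, with $Z_{N,\beta,\alpha_N}$ the normalizing constant. $m^*=m^*(\beta)$ denotes the largest solution of $x=\tanh(\beta x)$. *)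

theory Defs
  imports "HOL-Probability.Probability"
begin

text \<open>
  \<open>b\<close> is \<open>N \<mapsto> b\<^sub>N\<close>. The limit \<open>N \<rightarrow> \<infinity>\<close> runs along those \<open>N\<close> for which \<open>N - b\<^sub>N\<close> is a
  nonnegative even number; \<open>b\<^sub>N \<le> N\<close> is stated because subtraction on \<^typ>\<open>nat\<close> truncates.
\<close>

definition admissible :: "(nat \<Rightarrow> nat) \<Rightarrow> nat set" where
  "admissible b = {N. b N \<le> N \<and> even (N - b N)}"

definition admissible_at_top :: "(nat \<Rightarrow> nat) \<Rightarrow> nat filter" where
  "admissible_at_top b = inf sequentially (principal (admissible b))"

text \<open>
  Blocks are indexed by the three-element type \<open>3\<close>, so that the magnetization vector lives in
  \<^typ>\<open>real ^ 3\<close>.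
\<close>

definition three_blocks :: "nat \<Rightarrow> nat \<Rightarrow> (3 \<Rightarrow> nat set) \<Rightarrow> bool" where
  "three_blocks N n B \<longleftrightarrow>
     disjoint_family B \<and> (\<Union>k. B k) = {1..N} \<and>
     card (B 2) = n \<and>
     real (card (B 1)) = (real N - real n) / 2 \<and>
     real (card (B 3)) = (real N - real n) / 2"

definition spin_configs :: "nat \<Rightarrow> (nat \<Rightarrow> real) set" where
  "spin_configs N = {1..N} \<rightarrow>\<^sub>E {-1, 1}"

definition magnetization :: "(3 \<Rightarrow> nat set) \<Rightarrow> (nat \<Rightarrow> real) \<Rightarrow> real ^ 3" where
  "magnetization B \<sigma> = (\<chi> k. (\<Sum>i\<in>B k. \<sigma> i) / card (B k))"

definition hamiltonian :: "real \<Rightarrow> real \<Rightarrow> (3 \<Rightarrow> nat set) \<Rightarrow> (nat \<Rightarrow> real) \<Rightarrow> real" where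
  "hamiltonian \<beta> \<alpha> B \<sigma> =
     (let m = magnetization B \<sigma> in
       - (\<Sum>k\<in>UNIV. \<beta> / 2 * card (B k) * (m $ k)\<^sup>2)
       - \<alpha> * sqrt (real (card (B 1)) * real (card (B 2))) * m $ 1 * m $ 2
       - \<alpha> * sqrt (real (card (B 3)) * real (card (B 2))) * m $ 3 * m $ 2)"

definition partition_function :: "nat \<Rightarrow> real \<Rightarrow> real \<Rightarrow> (3 \<Rightarrow> nat set) \<Rightarrow> real" where
  "partition_function N \<beta> \<alpha> B = (\<Sum>\<sigma>\<in>spin_configs N. exp (- hamiltonian \<beta> \<alpha> B \<sigma>) / 2 ^ N)"

definition gibbs_measure :: "nat \<Rightarrow> real \<Rightarrow> real \<Rightarrow> (3 \<Rightarrow> nat set) \<Rightarrow> (nat \<Rightarrow> real) measure" where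
  "gibbs_measure N \<beta> \<alpha> B =
     point_measure (spin_configs N)
       (\<lambda>\<sigma>. ennreal (exp (- hamiltonian \<beta> \<alpha> B \<sigma>) / 2 ^ N / partition_function N \<beta> \<alpha> B))"

definition magnetization_law :: "nat \<Rightarrow> real \<Rightarrow> real \<Rightarrow> (3 \<Rightarrow> nat set) \<Rightarrow> (real ^ 3) measure" where
  "magnetization_law N \<beta> \<alpha> B = distr (gibbs_measure N \<beta> \<alpha> B) borel (magnetization B)"

definition m_star :: "real \<Rightarrow> real" where
  "m_star \<beta> = (GREATEST x. x = tanh (\<beta> * x))"

text \<open>
  The library's \<^const>\<open>weak_conv_m\<close> covers only sequences of measures on \<^typ>\<open>real\<close>.
\<close>

definition converges_weakly :: "('i \<Rightarrow> 'a::topological_space measure) \<Rightarrow> 'a measure \<Rightarrow> 'i filter \<Rightarrow> bool" where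
  "converges_weakly M L F \<longleftrightarrow>
     (\<forall>f :: 'a \<Rightarrow> real. continuous_on UNIV f \<and> bounded (range f) \<longrightarrow>
        ((\<lambda>i. \<integral>x. f x \<partial>M i) \<longlongrightarrow> (\<integral>x. f x \<partial>L)) F)"

text \<open>\<open>(\<delta>\<^bsub>x\<^sub>1\<^esub> + \<dots> + \<delta>\<^bsub>x\<^sub>n\<^esub>) / n\<close> for the list \<open>[x\<^sub>1, \<dots>, x\<^sub>n]\<close> of points.\<close>

definition dirac_average :: "'a::topological_space list \<Rightarrow> 'a measure" where
  "dirac_average xs =
     measure_of UNIV (sets borel)
       (\<lambda>A. (\<Sum>x\<leftarrow>xs. emeasure (return borel x) A) / of_nat (length xs))"

lemma sets_dirac_average [simp]: "sets (dirac_average xs) = sets borel"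
  unfolding dirac_average_def by (metis sets.sets_measure_of_eq space_borel)

lemma emeasure_dirac_average:
  assumes "A \<in> sets borel"
  shows "emeasure (dirac_average xs) A =
           (\<Sum>x\<leftarrow>xs. emeasure (return borel x) A) / of_nat (length xs)"
proof (rule emeasure_measure_of[OF dirac_average_def])
  have list: "(\<Sum>n. \<Sum>x\<leftarrow>ys. emeasure (return borel x) (F n)) =
      (\<Sum>x\<leftarrow>ys. emeasure (return borel x) (\<Union>n. F n))"
    if "range F \<subseteq> sets borel" "disjoint_family F" for F :: "nat \<Rightarrow> 'a set" and ys
  proof (induction ys)
    case (Cons y ys)
    have "(\<Sum>n. emeasure (return borel y) (F n)) = emeasure (return borel y) (\<Union>n. F n)"
      using that by (intro suminf_emeasure) auto
    with Cons show ?case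
      by (simp add: suminf_add[symmetric] del: emeasure_return)
  qed simp
  show "countably_additive (sets (dirac_average xs))
      (\<lambda>A. (\<Sum>x\<leftarrow>xs. emeasure (return borel x) A) / of_nat (length xs))"
    by (auto simp: countably_additive_def list divide_ennreal_def simp del: emeasure_return)
  show "positive (sets (dirac_average xs))
      (\<lambda>A. (\<Sum>x\<leftarrow>xs. emeasure (return borel x) A) / of_nat (length xs))"
    by (induction xs) (auto simp: positive_def divide_ennreal_def)
qed (use assms in auto)

lemma prob_space_dirac_average:
  assumes "xs \<noteq> []"
  shows "prob_space (dirac_average xs)"
proof
  have "space (dirac_average xs) = UNIV"
    using sets_eq_imp_space_eq[OF sets_dirac_average] by simp
  moreover have "(\<Sum>x\<leftarrow>xs. emeasure (return borel x) UNIV) = of_nat (length xs)"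
    by (induction xs) auto
  ultimately show "emeasure (dirac_average xs) (space (dirac_average xs)) = 1"
    using assms
    by (simp add: emeasure_dirac_average ennreal_divide_self of_nat_less_top del: emeasure_return)
qed

lemma finite_spin_configs: "finite (spin_configs N)"
  by (simp add: spin_configs_def finite_PiE)

lemma partition_function_pos: "partition_function N \<beta> \<alpha> B > 0"
proof -
  have "spin_configs N \<noteq> {}" by (auto simp: spin_configs_def PiE_eq_empty_iff)
  then show ?thesis
    unfolding partition_function_def by (intro sum_pos finite_spin_configs) auto
qed

lemma prob_space_gibbs_measure: "prob_space (gibbs_measure N \<beta> \<alpha> B)"
proof
  let ?Z = "partition_function N \<beta> \<alpha> B"
  have "emeasure (gibbs_measure N \<beta> \<alpha> B) (space (gibbs_measure N \<beta> \<alpha> B)) =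
      (\<Sum>\<sigma>\<in>spin_configs N. ennreal (exp (- hamiltonian \<beta> \<alpha> B \<sigma>) / 2 ^ N / ?Z))"
    by (simp add: gibbs_measure_def emeasure_point_measure_finite finite_spin_configs space_point_measure)
  also have "\<dots> = ennreal (\<Sum>\<sigma>\<in>spin_configs N. exp (- hamiltonian \<beta> \<alpha> B \<sigma>) / 2 ^ N / ?Z)"
    using partition_function_pos[of N \<beta> \<alpha> B] by (intro sum_ennreal) auto
  also have "(\<Sum>\<sigma>\<in>spin_configs N. exp (- hamiltonian \<beta> \<alpha> B \<sigma>) / 2 ^ N / ?Z) = ?Z / ?Z"
    by (simp only: partition_function_def sum_divide_distrib)
  finally show "emeasure (gibbs_measure N \<beta> \<alpha> B) (space (gibbs_measure N \<beta> \<alpha> B)) = 1"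
    using partition_function_pos[of N \<beta> \<alpha> B] by simp
qed

lemma admissible_at_top_neq_bot:
  assumes "incseq b" and "(\<lambda>N. real (b N) / real N) \<longlonglongrightarrow> 0"
  shows "admissible_at_top b \<noteq> bot"
proof
  assume "admissible_at_top b = bot"
  then have "eventually (\<lambda>N. N \<notin> admissible b) sequentially"
    unfolding trivial_limit_def admissible_at_top_def eventually_inf_principal by simp
  moreover have "eventually (\<lambda>N. real (b N) / real N < 1 / 2) sequentially"
    using order_tendstoD(2)[OF assms(2), of "1 / 2"] by simp
  ultimately have "eventually (\<lambda>N. N \<notin> admissible b \<and> real (b N) / real N < 1 / 2 \<and> N > 0) sequentially"
    using eventually_gt_at_top[of 0] by eventually_elim auto
  then obtain K where K: "\<And>N. N \<ge> K \<Longrightarrow> N \<notin> admissible b \<and> real (b N) / real N < 1 / 2 \<and> N > 0"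
    unfolding eventually_sequentially by blast
  have half: "2 * b N < N" if "N \<ge> K" for N
  proof -
    have "real (b N) * 2 < real N"
      using K[OF that] by (auto simp: divide_less_eq)
    then show ?thesis by linarith
  qed
  have odd: "odd (N - b N)" if "N \<ge> K" for N
    using K[OF that] half[OF that] by (auto simp: admissible_def)
  have step: "b (Suc N) \<ge> Suc (b N)" if "N \<ge> K" for N
  proof -
    have "b N \<noteq> b (Suc N)"
      using odd[of N] odd[of "Suc N"] half[of N] half[of "Suc N"] that by (auto simp: Suc_diff_le)
    then show ?thesis using incseqD[OF assms(1), of N "Suc N"] by simp
  qed
  have "b (K + j) \<ge> j" for j
  proof (induction j)
    case (Suc j)
    then show ?case using step[of "K + j"] by simp
  qed simp
  from this[of "K + 1"] half[of "K + (K + 1)"] show False by simp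
qed

lemma tanh_fixpoint_greatest:
  fixes \<beta> :: real
  shows "\<exists>x. x = tanh (\<beta> * x) \<and> (\<forall>y. y = tanh (\<beta> * y) \<longrightarrow> y \<le> x)"
proof -
  define S where "S = {x::real. x = tanh (\<beta> * x)}"
  have "closed S"
    unfolding S_def by (intro closed_Collect_eq continuous_intros) auto
  moreover have "bounded S"
  proof (rule boundedI[of _ 1])
    fix x assume "x \<in> S"
    then have "x = tanh (\<beta> * x)" by (simp add: S_def)
    then show "norm x \<le> 1"
      using tanh_real_bounds[of "\<beta> * x"] by (auto simp: abs_le_iff)
  qed
  ultimately have "compact S" by (simp add: compact_eq_bounded_closed)
  moreover have "S \<noteq> {}" by (auto simp: S_def intro: exI[of _ 0])
  ultimately show ?thesis
    using compact_attains_sup[of S] by (auto simp: S_def)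
qed

lemma m_star_fixpoint: "m_star \<beta> = tanh (\<beta> * m_star \<beta>)"
  and m_star_greatest: "x = tanh (\<beta> * x) \<Longrightarrow> x \<le> m_star \<beta>"
proof -
  obtain z where z: "z = tanh (\<beta> * z)" "\<And>y. y = tanh (\<beta> * y) \<Longrightarrow> y \<le> z"
    using tanh_fixpoint_greatest by blast
  have "m_star \<beta> = z"
    unfolding m_star_def using z by (rule Greatest_equality)
  with z show "m_star \<beta> = tanh (\<beta> * m_star \<beta>)" "x = tanh (\<beta> * x) \<Longrightarrow> x \<le> m_star \<beta>"
    by auto
qed

end

theory Submission
  imports Defs
begin

text \<open>
  Write \<open>n = |B\<^sub>1| = |B\<^sub>3|\<close>, \<open>b = |B\<^sub>2|\<close> and \<open>J = \<alpha> sqrt (n b)\<close>. The interacting Gibbs measure has density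
  proportional to \<open>exp (J m\<^sub>2 (m\<^sub>1 + m\<^sub>3))\<close> with respect to the decoupled one, under which the blocks are
  Curie--Weiss models. The proof compares these two measures and uses three facts about the
  decoupled model: every \<open>|m\<^sub>k|\<close> is within a fixed small \<open>\<eta>\<close> of \<open>m\<^sup>*\<close> up to an error \<open>K exp (- c |B\<^sub>k|)\<close>
  (\<open>decoupled_far_le\<close>), the law is invariant under independent flips of the blocks
  (\<open>decoupled_flip\<close>), and a block is fully aligned upwards with probability at least
  \<open>2\<close> to the power \<open>- |B\<^sub>k|\<close> (\<open>decoupled_aligned_ge\<close>). The exponential bound comes from
  linearising the square in the exponent, which compares a block with product measures, from
  below at the best slope and from above locally.

  Since \<open>J / n = \<alpha> sqrt (b / n)\<close> tends to \<open>0\<close>, the interaction, at most \<open>2 J\<close>, never moves the outer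
  magnetizations away from \<open>\<plusminus> m\<^sup>*\<close>. What remains is decided by comparing exponents.

  \<^item> If \<open>J \<longlongrightarrow> 0\<close> (third regime), the density tends to \<open>1\<close> uniformly and the law is that of the
    decoupled model (\<open>gibbs_mean_close_to_decoupled\<close>).
  \<^item> If \<open>J \<longlongrightarrow> \<infinity>\<close> and \<open>J / b \<longlongrightarrow> 0\<close> (second regime), the middle block stays near \<open>\<plusminus> m\<^sup>*\<close> as well.
    All signs equal gives a weight \<open>exp (2 J (m\<^sup>* - \<eta>)\<^sup>2)\<close>; any other choice of signs yields at most
    \<open>exp (2 J \<eta>)\<close>, because opposed outer blocks exert a field of size at most \<open>2 \<eta>\<close>
    and a middle block opposed to both of them makes the interaction negative
    (\<open>weak_field_concentration\<close>).
  \<^item> If \<open>J / b \<longlongrightarrow> \<infinity>\<close> (first regime), the entropy of the middle block, of order \<open>b\<close>, is negligible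
    against \<open>J\<close>. The fully aligned middle block together with equal outer signs gives a weight
    of at least \<open>exp (2 J (m\<^sup>* - \<eta>) - O(b))\<close>, which beats every alternative
    (\<open>strong_field_concentration\<close>).

  These estimates locate the magnetization up to the symmetries of the model, a common flip or,
  without interaction, all flips. The symmetry then distributes the mass evenly
  (\<open>gibbs_mean_tendsto_orbit_average\<close>).
\<close>

section \<open>The mean-field free energy\<close>

text \<open>
  Linearising \<open>m\<^sup>2 \<ge> 2 m y - y\<^sup>2\<close> in the exponent turns the Curie--Weiss weight of a block of
  \<open>n\<close> spins into a product weight, whose normalisation is \<open>exp (n g(y))\<close> with the function
  \<open>g\<close> below. It controls the block from below (take the best \<open>y\<close>) and, locally, from above.
\<close>

definition mf_energy :: "real \<Rightarrow> real \<Rightarrow> real" where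
  "mf_energy \<beta> y = ln (cosh (\<beta> * y)) - \<beta> / 2 * y\<^sup>2"

lemma mf_energy_minus [simp]: "mf_energy \<beta> (- y) = mf_energy \<beta> y"
  by (simp add: mf_energy_def)

lemma DERIV_mf_energy:
  "(mf_energy \<beta> has_real_derivative \<beta> * (tanh (\<beta> * y) - y)) (at y)"
  unfolding mf_energy_def
  by (auto intro!: derivative_eq_intros simp: tanh_def field_simps)

lemma continuous_on_mf_energy: "continuous_on A (mf_energy \<beta>)"
  by (intro continuous_at_imp_continuous_on ballI DERIV_isCont[OF DERIV_mf_energy])

lemma DERIV_tanh_minus_id:
  "((\<lambda>y. tanh (\<beta> * y) - y) has_real_derivative \<beta> * (1 - (tanh (\<beta> * y))\<^sup>2) - 1) (at y)"
  for \<beta> :: real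
  by (auto intro!: derivative_eq_intros)

lemma continuous_on_tanh_minus_id: "continuous_on A (\<lambda>y::real. tanh (\<beta> * y) - y)"
  by (intro continuous_at_imp_continuous_on ballI DERIV_isCont[OF DERIV_tanh_minus_id])

lemma tanh_minus_id_pos_near_zero:
  fixes \<beta> :: real
  assumes "\<beta> > 1"
  shows "\<exists>d>0. \<forall>h>0. h < d \<longrightarrow> 0 < tanh (\<beta> * h) - h"
proof -
  have "\<exists>d>0. \<forall>h>0. h < d \<longrightarrow>
      tanh (\<beta> * 0) - 0 < tanh (\<beta> * (0 + h)) - (0 + h)"
    by (rule DERIV_pos_inc_right[OF DERIV_tanh_minus_id[of \<beta> 0]]) (use assms in simp)
  then show ?thesis by simp
qed

lemma m_star_bounds:
  assumes "\<beta> > 1"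
  shows "0 < m_star \<beta>" "m_star \<beta> < 1"
proof -
  obtain d where d: "d > 0" "\<And>h. 0 < h \<Longrightarrow> h < d \<Longrightarrow> 0 < tanh (\<beta> * h) - h"
    using tanh_minus_id_pos_near_zero[OF assms] by blast
  define h where "h = min (d / 2) (1 / 2)"
  have h: "0 < h" "h < d" "h \<le> 1" using d(1) by (auto simp: h_def)
  have "\<exists>x. h \<le> x \<and> x \<le> 1 \<and> tanh (\<beta> * x) - x = 0"
    using d(2)[of h] h tanh_real_lt_1[of \<beta>]
    by (intro IVT2' continuous_on_tanh_minus_id) auto
  then obtain x where "h \<le> x" "x = tanh (\<beta> * x)" by auto
  with m_star_greatest[of x \<beta>] h show "0 < m_star \<beta>" by linarith
  show "m_star \<beta> < 1"
    using tanh_real_lt_1[of "\<beta> * m_star \<beta>"] m_star_fixpoint[of \<beta>] by simp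
qed

text \<open>
  Two positive fixed points would, by Rolle's theorem, give two positive critical points of
  \<open>tanh (\<beta> y) - y\<close>, although its derivative is strictly decreasing there.
\<close>

lemma tanh_fixpoint_unique:
  assumes "\<beta> > 1" "0 < x" "x = tanh (\<beta> * x)"
  shows "x = m_star \<beta>"
proof (rule ccontr)
  let ?\<phi> = "\<lambda>y. tanh (\<beta> * y) - y"
  assume "x \<noteq> m_star \<beta>"
  with m_star_greatest[OF assms(3)] have lt: "x < m_star \<beta>" by simp
  have "\<exists>z. 0 < z \<and> z < x \<and> DERIV ?\<phi> z :> 0"
    using assms
    by (intro Rolle continuous_on_tanh_minus_id)
       (use DERIV_tanh_minus_id in \<open>auto simp: real_differentiable_def\<close>)
  then obtain z1 where z1: "0 < z1" "z1 < x" "DERIV ?\<phi> z1 :> 0" by blast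
  have "\<exists>z. x < z \<and> z < m_star \<beta> \<and> DERIV ?\<phi> z :> 0"
    using assms lt m_star_fixpoint[of \<beta>]
    by (intro Rolle continuous_on_tanh_minus_id)
       (use DERIV_tanh_minus_id in \<open>auto simp: real_differentiable_def\<close>)
  then obtain z2 where z2: "x < z2" "DERIV ?\<phi> z2 :> 0" by blast
  have "\<beta> * (1 - (tanh (\<beta> * z1))\<^sup>2) - 1 = 0" "\<beta> * (1 - (tanh (\<beta> * z2))\<^sup>2) - 1 = 0"
    using DERIV_unique[OF DERIV_tanh_minus_id z1(3)] DERIV_unique[OF DERIV_tanh_minus_id z2(2)]
    by simp_all
  then have "\<beta> * (tanh (\<beta> * z1))\<^sup>2 = \<beta> * (tanh (\<beta> * z2))\<^sup>2" by (simp only: right_diff_distrib)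
  then have "(tanh (\<beta> * z1))\<^sup>2 = (tanh (\<beta> * z2))\<^sup>2" using assms by simp
  moreover have "0 \<le> tanh (\<beta> * z1)" "tanh (\<beta> * z1) < tanh (\<beta> * z2)"
    using assms z1 z2 by auto
  then have "(tanh (\<beta> * z1))\<^sup>2 < (tanh (\<beta> * z2))\<^sup>2"
    by (intro power_strict_mono) auto
  ultimately show False by simp
qed

lemma tanh_gt_below_m_star:
  assumes "\<beta> > 1" "0 < y" "y < m_star \<beta>"
  shows "y < tanh (\<beta> * y)"
proof (rule ccontr)
  assume "\<not> y < tanh (\<beta> * y)"
  obtain d where d: "d > 0" "\<And>h. 0 < h \<Longrightarrow> h < d \<Longrightarrow> 0 < tanh (\<beta> * h) - h"
    using tanh_minus_id_pos_near_zero[OF assms(1)] by blast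
  define h where "h = min (d / 2) y"
  have h: "0 < h" "h < d" "h \<le> y" using d(1) assms by (auto simp: h_def)
  have "\<exists>x. h \<le> x \<and> x \<le> y \<and> tanh (\<beta> * x) - x = 0"
    using d(2)[of h] h \<open>\<not> y < tanh (\<beta> * y)\<close>
    by (intro IVT2' continuous_on_tanh_minus_id) auto
  then obtain x where "h \<le> x" "x \<le> y" "x = tanh (\<beta> * x)" by auto
  with tanh_fixpoint_unique[of \<beta> x] h assms show False by linarith
qed

lemma tanh_lt_above_m_star:
  assumes "m_star \<beta> < y"
  shows "tanh (\<beta> * y) < y"
proof (rule ccontr)
  assume "\<not> tanh (\<beta> * y) < y"
  then have "y \<le> 1" using tanh_real_lt_1[of "\<beta> * y"] by linarith
  have "\<exists>x. y \<le> x \<and> x \<le> 1 \<and> tanh (\<beta> * x) - x = 0"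
    using \<open>y \<le> 1\<close> \<open>\<not> tanh (\<beta> * y) < y\<close> tanh_real_lt_1[of \<beta>]
    by (intro IVT2' continuous_on_tanh_minus_id) auto
  then obtain x where "y \<le> x" "x = tanh (\<beta> * x)" by auto
  with m_star_greatest[of x \<beta>] assms show False by linarith
qed

text \<open>
  The derivative \<open>\<beta> (tanh (\<beta> y) - y)\<close> is positive on \<open>(0, m\<^sup>*)\<close> and negative beyond \<open>m\<^sup>*\<close>, and the
  free energy is even.
\<close>

lemma mf_energy_strict_max:
  assumes "\<beta> > 1" "\<bar>y\<bar> \<noteq> m_star \<beta>"
  shows "mf_energy \<beta> y < mf_energy \<beta> (m_star \<beta>)"
proof -
  have "mf_energy \<beta> \<bar>y\<bar> < mf_energy \<beta> (m_star \<beta>)"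
  proof (cases "\<bar>y\<bar> < m_star \<beta>")
    case True
    show ?thesis
    proof (rule DERIV_pos_imp_increasing_open[OF True _ continuous_on_mf_energy])
      fix x assume "\<bar>y\<bar> < x" "x < m_star \<beta>"
      then have "0 < \<beta> * (tanh (\<beta> * x) - x)"
        using assms(1) tanh_gt_below_m_star[of \<beta> x] by simp
      with DERIV_mf_energy show "\<exists>D. DERIV (mf_energy \<beta>) x :> D \<and> 0 < D" by blast
    qed
  next
    case False
    with assms(2) have less: "m_star \<beta> < \<bar>y\<bar>" by simp
    show ?thesis
    proof (rule DERIV_neg_imp_decreasing_open[OF less _ continuous_on_mf_energy])
      fix x assume "m_star \<beta> < x" "x < \<bar>y\<bar>"
      then have "\<beta> * (tanh (\<beta> * x) - x) < 0"
        using assms(1) tanh_lt_above_m_star[of \<beta> x] by (intro mult_pos_neg) auto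
      with DERIV_mf_energy show "\<exists>D. DERIV (mf_energy \<beta>) x :> D \<and> D < 0" by blast
    qed
  qed
  then show ?thesis by (auto simp: abs_if split: if_splits)
qed

text \<open>Magnetizations that are not close to \<open>\<plusminus> m\<^sup>*\<close>, the values that a decoupled block avoids.\<close>

definition far_set :: "real \<Rightarrow> real \<Rightarrow> real set" where
  "far_set \<beta> \<epsilon> = {y. \<bar>y\<bar> \<le> 1 \<and> \<epsilon> \<le> \<bar>\<bar>y\<bar> - m_star \<beta>\<bar>}"

lemma compact_far_set: "compact (far_set \<beta> \<epsilon>)"
proof -
  have "closed (far_set \<beta> \<epsilon>)" unfolding far_set_def
    by (intro closed_Collect_conj closed_Collect_le continuous_intros)
  moreover have "bounded (far_set \<beta> \<epsilon>)"
    by (rule boundedI[of _ 1]) (auto simp: far_set_def)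
  ultimately show ?thesis by (simp add: compact_eq_bounded_closed)
qed

lemma mf_energy_gap:
  assumes "\<beta> > 1" "\<epsilon> > 0"
  shows "\<exists>c>0. \<forall>y\<in>far_set \<beta> \<epsilon>. mf_energy \<beta> y \<le> mf_energy \<beta> (m_star \<beta>) - c"
proof (cases "far_set \<beta> \<epsilon> = {}")
  case False
  obtain z where z: "z \<in> far_set \<beta> \<epsilon>" "\<And>y. y \<in> far_set \<beta> \<epsilon> \<Longrightarrow> mf_energy \<beta> y \<le> mf_energy \<beta> z"
    using continuous_attains_sup[OF compact_far_set False continuous_on_mf_energy] by blast
  have "mf_energy \<beta> z < mf_energy \<beta> (m_star \<beta>)"
    using z(1) assms by (intro mf_energy_strict_max) (auto simp: far_set_def)
  with z(2) show ?thesis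
    by (intro exI[of _ "mf_energy \<beta> (m_star \<beta>) - mf_energy \<beta> z"]) auto
qed (auto intro: exI[of _ 1])

section \<open>A single Curie--Weiss block\<close>

definition spins :: "nat set \<Rightarrow> (nat \<Rightarrow> real) set" where
  "spins A = A \<rightarrow>\<^sub>E {-1, 1}"

definition block_mean :: "nat set \<Rightarrow> (nat \<Rightarrow> real) \<Rightarrow> real" where
  "block_mean A \<sigma> = (\<Sum>i\<in>A. \<sigma> i) / card A"

definition cw_weight :: "real \<Rightarrow> nat set \<Rightarrow> (nat \<Rightarrow> real) \<Rightarrow> real" where
  "cw_weight \<beta> A \<sigma> = exp (\<beta> / 2 * card A * (block_mean A \<sigma>)\<^sup>2)"

lemma finite_spins [simp]: "finite A \<Longrightarrow> finite (spins A)"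
  by (simp add: spins_def finite_PiE)

lemma card_spins: "finite A \<Longrightarrow> card (spins A) = 2 ^ card A"
  by (simp add: spins_def card_PiE numeral_2_eq_2)

lemma block_mean_bound:
  assumes "\<sigma> \<in> A \<rightarrow> {-1, 1}"
  shows "\<bar>block_mean A \<sigma>\<bar> \<le> 1"
proof -
  have "\<bar>\<Sum>i\<in>A. \<sigma> i\<bar> \<le> (\<Sum>i\<in>A. \<bar>\<sigma> i\<bar>)" by (rule sum_abs)
  also have "\<dots> \<le> (\<Sum>i\<in>A. 1)" using assms by (intro sum_mono) (force simp: Pi_iff)
  finally have "\<bar>\<Sum>i\<in>A. \<sigma> i\<bar> \<le> card A" by simp
  then show ?thesis by (simp add: block_mean_def divide_le_eq)
qed

lemma card_times_block_mean:
  "finite A \<Longrightarrow> card A * block_mean A \<sigma> = (\<Sum>i\<in>A. \<sigma> i)"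
  by (cases "A = {}") (auto simp: block_mean_def)

text \<open>Under a product weight the spins decouple, so the moment generating function is exact.\<close>

lemma sum_exp_block_mean:
  fixes t :: real
  assumes "finite A"
  shows "(\<Sum>\<sigma>\<in>spins A. exp (t * (card A * block_mean A \<sigma>))) = (2 * cosh t) ^ card A"
proof -
  have "(2 * cosh t) ^ card A = (\<Prod>i\<in>A. \<Sum>s\<in>{-1, 1}. exp (t * s))"
    by (simp add: cosh_def algebra_simps)
  also have "\<dots> = (\<Sum>\<sigma>\<in>spins A. \<Prod>i\<in>A. exp (t * \<sigma> i))"
    unfolding spins_def by (rule prod_sum_PiE) (use assms in auto)
  finally show ?thesis
    using assms by (simp add: exp_sum sum_distrib_left card_times_block_mean)
qed

lemma sum_exp_linearised:
  fixes \<beta> y :: real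
  assumes "finite A"
  shows "(\<Sum>\<sigma>\<in>spins A. exp (\<beta> * card A * (y * block_mean A \<sigma> - y\<^sup>2 / 2))) =
    2 ^ card A * exp (card A * mf_energy \<beta> y)"
proof -
  have "(\<Sum>\<sigma>\<in>spins A. exp (\<beta> * card A * (y * block_mean A \<sigma> - y\<^sup>2 / 2))) =
      (\<Sum>\<sigma>\<in>spins A. exp (\<beta> * y * (card A * block_mean A \<sigma>))) * exp (- (\<beta> / 2 * y\<^sup>2 * card A))"
    by (simp add: sum_distrib_right flip: exp_add) (simp add: algebra_simps)
  also have "\<dots> = 2 ^ card A * (cosh (\<beta> * y) ^ card A * exp (- (\<beta> / 2 * y\<^sup>2 * card A)))"
    using assms by (simp add: sum_exp_block_mean power_mult_distrib)
  also have "cosh (\<beta> * y) ^ card A = exp (card A * ln (cosh (\<beta> * y)))"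
    by (simp add: exp_of_nat_mult)
  finally show ?thesis
    by (simp add: mf_energy_def algebra_simps flip: exp_add)
qed

lemma cw_partition_ge:
  assumes "finite A" "\<beta> \<ge> 0"
  shows "2 ^ card A * exp (card A * mf_energy \<beta> y) \<le> (\<Sum>\<sigma>\<in>spins A. cw_weight \<beta> A \<sigma>)"
proof -
  have "y * x - y\<^sup>2 / 2 \<le> x\<^sup>2 / 2" for x :: real
    using zero_le_power2[of "x - y"] by (simp add: power2_eq_square algebra_simps)
  then have "\<beta> * card A * (y * x - y\<^sup>2 / 2) \<le> \<beta> * card A * (x\<^sup>2 / 2)" for x
    using assms by (intro mult_left_mono) auto
  then have "\<beta> * card A * (y * x - y\<^sup>2 / 2) \<le> \<beta> / 2 * card A * x\<^sup>2" for x
    by (simp only: times_divide_eq_left times_divide_eq_right)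
  then have "(\<Sum>\<sigma>\<in>spins A. exp (\<beta> * card A * (y * block_mean A \<sigma> - y\<^sup>2 / 2)))
      \<le> (\<Sum>\<sigma>\<in>spins A. cw_weight \<beta> A \<sigma>)"
    unfolding cw_weight_def by (intro sum_mono iffD2[OF exp_le_cancel_iff])
  then show ?thesis by (simp only: sum_exp_linearised[OF assms(1)])
qed

text \<open>
  Near \<open>y\<close> the linearisation loses at most \<open>(m - y)\<^sup>2 / 2\<close>. Covering the magnetizations far
  from \<open>\<plusminus> m\<^sup>*\<close> by finitely many small intervals, so short that this loss is below the gap of the
  free energy, gives an exponential bound on their weight.
\<close>

lemma cw_far_weight_le:
  assumes "\<beta> > 1" "\<epsilon> > 0"
  shows "\<exists>K>0::real. \<exists>c>0::real. \<forall>A. finite A \<longrightarrow>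
    (\<Sum>\<sigma>\<in>spins A. cw_weight \<beta> A \<sigma> * of_bool (block_mean A \<sigma> \<in> far_set \<beta> \<epsilon>))
      \<le> K * exp (- c * card A) * (\<Sum>\<sigma>\<in>spins A. cw_weight \<beta> A \<sigma>)"
proof -
  obtain c where c: "c > 0"
    "\<And>y. y \<in> far_set \<beta> \<epsilon> \<Longrightarrow> mf_energy \<beta> y \<le> mf_energy \<beta> (m_star \<beta>) - c"
    using mf_energy_gap[OF assms] by blast
  \<comment> \<open>half of the gap \<open>c\<close> pays for the linearisation error \<open>\<beta> \<delta>\<^sup>2 / 2\<close>\<close>
  define \<delta> where "\<delta> = sqrt (c / \<beta>)"
  have \<delta>: "\<delta> > 0" "\<beta> / 2 * \<delta>\<^sup>2 = c / 2" using c assms by (auto simp: \<delta>_def)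
  obtain Y where Y: "finite Y" "Y \<subseteq> far_set \<beta> \<epsilon>" "far_set \<beta> \<epsilon> \<subseteq> (\<Union>y\<in>Y. ball y \<delta>)"
    using compactE_image[OF compact_far_set, of "far_set \<beta> \<epsilon>" "\<lambda>y. ball y \<delta>" \<beta> \<epsilon>] \<delta>(1)
    by (metis UN_I centre_in_ball open_ball subsetI)
  have "(\<Sum>\<sigma>\<in>spins A. cw_weight \<beta> A \<sigma> * of_bool (block_mean A \<sigma> \<in> far_set \<beta> \<epsilon>))
      \<le> (card Y + 1) * exp (- (c / 2) * card A) * (\<Sum>\<sigma>\<in>spins A. cw_weight \<beta> A \<sigma>)"
    if "finite A" for A :: "nat set"
  proof -
    let ?n = "real (card A)"
    let ?lin = "\<lambda>y \<sigma>. exp (\<beta> * card A * (y * block_mean A \<sigma> - y\<^sup>2 / 2))"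
    have pointwise: "cw_weight \<beta> A \<sigma> * of_bool (block_mean A \<sigma> \<in> far_set \<beta> \<epsilon>)
        \<le> (\<Sum>y\<in>Y. exp (c / 2 * ?n) * ?lin y \<sigma>)" for \<sigma>
    proof (cases "block_mean A \<sigma> \<in> far_set \<beta> \<epsilon>")
      case True
      let ?m = "block_mean A \<sigma>"
      obtain y where y: "y \<in> Y" "\<bar>y - ?m\<bar> < \<delta>"
        using Y(3) True by (auto simp: dist_real_def)
      have "(y - ?m)\<^sup>2 \<le> \<delta>\<^sup>2" using y(2) by (intro abs_le_square_iff[THEN iffD1]) simp
      then have "\<beta> / 2 * ?n * (y - ?m)\<^sup>2 \<le> \<beta> / 2 * ?n * \<delta>\<^sup>2"
        using assms by (intro mult_left_mono) auto
      also have "\<dots> = c / 2 * ?n" using \<delta>(2) by (simp add: algebra_simps)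
      finally have "\<beta> / 2 * ?n * ?m\<^sup>2 \<le> c / 2 * ?n + \<beta> * ?n * (y * ?m - y\<^sup>2 / 2)"
        by (simp add: power2_eq_square algebra_simps)
      then have "cw_weight \<beta> A \<sigma> \<le> exp (c / 2 * ?n) * ?lin y \<sigma>"
        unfolding cw_weight_def exp_add[symmetric] by simp
      also have "\<dots> \<le> (\<Sum>y\<in>Y. exp (c / 2 * ?n) * ?lin y \<sigma>)"
        using y(1) Y(1) by (intro member_le_sum) auto
      finally show ?thesis using True by simp
    qed (auto intro: sum_nonneg)
    have "(\<Sum>\<sigma>\<in>spins A. cw_weight \<beta> A \<sigma> * of_bool (block_mean A \<sigma> \<in> far_set \<beta> \<epsilon>))
        \<le> (\<Sum>\<sigma>\<in>spins A. \<Sum>y\<in>Y. exp (c / 2 * ?n) * ?lin y \<sigma>)"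
      by (intro sum_mono pointwise)
    also have "\<dots> = (\<Sum>y\<in>Y. exp (c / 2 * ?n) * (\<Sum>\<sigma>\<in>spins A. ?lin y \<sigma>))"
      unfolding sum_distrib_left by (rule sum.swap)
    also have "\<dots> = (\<Sum>y\<in>Y. exp (c / 2 * ?n) * (2 ^ card A * exp (?n * mf_energy \<beta> y)))"
      by (simp only: sum_exp_linearised[OF that])
    also have "\<dots> \<le> (\<Sum>y\<in>Y. exp (c / 2 * ?n) *
        (2 ^ card A * exp (?n * (mf_energy \<beta> (m_star \<beta>) - c))))"
      using Y(2) c(2) by (intro sum_mono mult_left_mono) (auto intro!: mult_left_mono)
    also have "\<dots> = card Y * exp (- (c / 2) * ?n) *
        (2 ^ card A * exp (?n * mf_energy \<beta> (m_star \<beta>)))"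
      by (simp add: algebra_simps flip: exp_add)
    also have "\<dots> \<le> (card Y + 1) * exp (- (c / 2) * ?n) * (\<Sum>\<sigma>\<in>spins A. cw_weight \<beta> A \<sigma>)"
      using assms by (intro mult_mono cw_partition_ge that) auto
    finally show ?thesis .
  qed
  then show ?thesis using c(1)
    by (intro exI[of _ "real (card Y + 1)"] conjI exI[of _ "c / 2"] allI impI) simp_all
qed

text \<open>The fully aligned configuration has the largest weight among the \<open>2\<^sup>n\<close> configurations.\<close>

lemma cw_aligned_weight_ge:
  assumes "finite A" "A \<noteq> {}" "\<beta> \<ge> 0"
  shows "(\<Sum>\<sigma>\<in>spins A. cw_weight \<beta> A \<sigma>)
    \<le> 2 ^ card A * (\<Sum>\<sigma>\<in>spins A. cw_weight \<beta> A \<sigma> * of_bool (block_mean A \<sigma> = 1))"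
proof -
  let ?one = "\<lambda>i\<in>A. 1::real"
  have mean_one: "block_mean A ?one = 1"
    using assms by (simp add: block_mean_def)
  have le: "cw_weight \<beta> A \<sigma> \<le> cw_weight \<beta> A ?one" if "\<sigma> \<in> spins A" for \<sigma>
  proof -
    have "(block_mean A \<sigma>)\<^sup>2 \<le> 1"
      using block_mean_bound[of \<sigma> A] that by (auto simp: spins_def abs_square_le_1)
    then show ?thesis
      unfolding cw_weight_def mean_one using assms by (auto intro!: mult_left_le)
  qed
  have "(\<Sum>\<sigma>\<in>spins A. cw_weight \<beta> A \<sigma>) \<le> real (card (spins A)) * cw_weight \<beta> A ?one"
    using le by (rule sum_bounded_above)
  also have "cw_weight \<beta> A ?one = cw_weight \<beta> A ?one * of_bool (block_mean A ?one = 1)"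
    by (simp add: mean_one)
  also have "\<dots> \<le> (\<Sum>\<sigma>\<in>spins A. cw_weight \<beta> A \<sigma> * of_bool (block_mean A \<sigma> = 1))"
    using assms
    by (intro member_le_sum[of ?one _ "\<lambda>\<sigma>. cw_weight \<beta> A \<sigma> * of_bool (block_mean A \<sigma> = 1)"])
       (simp_all add: cw_weight_def, simp add: spins_def)
  finally show ?thesis using assms by (simp add: card_spins)
qed

section \<open>Expectations under the Gibbs measure\<close>

definition gibbs_mean ::
    "nat \<Rightarrow> real \<Rightarrow> real \<Rightarrow> (3 \<Rightarrow> nat set) \<Rightarrow> (real ^ 3 \<Rightarrow> real) \<Rightarrow> real" where
  "gibbs_mean N \<beta> \<alpha> B F =
     (\<Sum>\<sigma>\<in>spin_configs N. exp (- hamiltonian \<beta> \<alpha> B \<sigma>) * F (magnetization B \<sigma>)) /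
     (\<Sum>\<sigma>\<in>spin_configs N. exp (- hamiltonian \<beta> \<alpha> B \<sigma>))"

lemma integral_magnetization_law:
  assumes "f \<in> borel_measurable borel"
  shows "(\<integral>v. f v \<partial>magnetization_law N \<beta> \<alpha> B) = gibbs_mean N \<beta> \<alpha> B f"
proof -
  let ?Z = "partition_function N \<beta> \<alpha> B"
  have Z: "(\<Sum>\<sigma>\<in>spin_configs N. exp (- hamiltonian \<beta> \<alpha> B \<sigma>)) = 2 ^ N * ?Z"
    by (simp add: partition_function_def sum_distrib_left)
  have "(\<integral>v. f v \<partial>magnetization_law N \<beta> \<alpha> B) =
      (\<integral>\<sigma>. f (magnetization B \<sigma>) \<partial>gibbs_measure N \<beta> \<alpha> B)"
    unfolding magnetization_law_def
    by (intro integral_distr assms) (simp add: gibbs_measure_def)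
  also have "\<dots> = (\<Sum>\<sigma>\<in>spin_configs N.
      exp (- hamiltonian \<beta> \<alpha> B \<sigma>) / 2 ^ N / ?Z * f (magnetization B \<sigma>))"
    unfolding gibbs_measure_def using partition_function_pos[of N \<beta> \<alpha> B]
    by (subst lebesgue_integral_point_measure_finite) (auto simp: finite_spin_configs)
  also have "\<dots> = gibbs_mean N \<beta> \<alpha> B f"
    unfolding gibbs_mean_def Z by (simp add: sum_divide_distrib)
  finally show ?thesis .
qed

lemma boltzmann_sum_pos: "0 < (\<Sum>\<sigma>\<in>spin_configs N. exp (- hamiltonian \<beta> \<alpha> B \<sigma>))"
proof -
  have "spin_configs N \<noteq> {}" by (auto simp: spin_configs_def PiE_eq_empty_iff)
  then show ?thesis by (intro sum_pos finite_spin_configs) auto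
qed

lemma gibbs_mean_add:
  "gibbs_mean N \<beta> \<alpha> B (\<lambda>v. F v + G v) = gibbs_mean N \<beta> \<alpha> B F + gibbs_mean N \<beta> \<alpha> B G"
  by (simp add: gibbs_mean_def distrib_left sum.distrib add_divide_distrib)

lemma gibbs_mean_cmult:
  "gibbs_mean N \<beta> \<alpha> B (\<lambda>v. c * F v) = c * gibbs_mean N \<beta> \<alpha> B F"
  by (simp add: gibbs_mean_def sum_distrib_left mult.left_commute)

lemma gibbs_mean_const [simp]: "gibbs_mean N \<beta> \<alpha> B (\<lambda>v. c) = c"
  using boltzmann_sum_pos[of \<beta> \<alpha> B N]
  by (simp add: gibbs_mean_def sum_distrib_right[symmetric])

lemma gibbs_mean_diff:
  "gibbs_mean N \<beta> \<alpha> B (\<lambda>v. F v - G v) = gibbs_mean N \<beta> \<alpha> B F - gibbs_mean N \<beta> \<alpha> B G"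
  using gibbs_mean_add[of N \<beta> \<alpha> B F "\<lambda>v. - 1 * G v"] gibbs_mean_cmult[of N \<beta> \<alpha> B "- 1" G]
  by simp

lemma gibbs_mean_sum_list:
  "gibbs_mean N \<beta> \<alpha> B (\<lambda>v. \<Sum>x\<leftarrow>xs. F x v) = (\<Sum>x\<leftarrow>xs. gibbs_mean N \<beta> \<alpha> B (F x))"
  by (induction xs) (simp_all add: gibbs_mean_add)

lemma three_blocksD:
  assumes "three_blocks N n B"
  shows "finite (B k)" "B k \<subseteq> {1..N}" "i \<in> B j \<Longrightarrow> i \<in> B k \<Longrightarrow> j = k"
    "card (B 2) = n" "card (B 3) = card (B 1)" "2 * real (card (B 1)) = real N - real n"
proof -
  show sub: "B k \<subseteq> {1..N}" using assms by (auto simp: three_blocks_def)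
  then show "finite (B k)" by (rule finite_subset) simp
  show "i \<in> B j \<Longrightarrow> i \<in> B k \<Longrightarrow> j = k"
    using assms by (auto simp: three_blocks_def disjoint_family_on_def)
  show "card (B 2) = n" "2 * real (card (B 1)) = real N - real n"
    using assms by (auto simp: three_blocks_def)
  have "real (card (B 3)) = real (card (B 1))" using assms by (simp add: three_blocks_def)
  then show "card (B 3) = card (B 1)" by simp
qed

lemma magnetization_nth: "magnetization B \<sigma> $ k = block_mean (B k) \<sigma>"
  by (simp add: magnetization_def block_mean_def)

lemma spin_configs_eq: "spin_configs N = spins {1..N}"
  by (simp add: spin_configs_def spins_def)

lemma abs_magnetization_le:
  assumes "three_blocks N n B" "\<sigma> \<in> spin_configs N"
  shows "\<bar>magnetization B \<sigma> $ k\<bar> \<le> 1"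
  unfolding magnetization_nth
  using assms(2) three_blocksD(2)[OF assms(1), of k]
  by (intro block_mean_bound) (fastforce simp: spin_configs_def)

lemma gibbs_mean_mono:
  assumes "three_blocks N n B" "\<And>v. (\<And>k. \<bar>v $ k\<bar> \<le> 1) \<Longrightarrow> F v \<le> G v"
  shows "gibbs_mean N \<beta> \<alpha> B F \<le> gibbs_mean N \<beta> \<alpha> B G"
  unfolding gibbs_mean_def
  using assms abs_magnetization_le[OF assms(1)] boltzmann_sum_pos[of \<beta> \<alpha> B N]
  by (intro divide_right_mono sum_mono mult_left_mono) auto

lemma gibbs_mean_nonneg:
  assumes "\<And>v. 0 \<le> F v"
  shows "0 \<le> gibbs_mean N \<beta> \<alpha> B F"
  unfolding gibbs_mean_def using assms by (intro divide_nonneg_nonneg sum_nonneg) auto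

lemma gibbs_mean_le_const:
  assumes "three_blocks N n B" "\<And>v. (\<And>k. \<bar>v $ k\<bar> \<le> 1) \<Longrightarrow> F v \<le> c"
  shows "gibbs_mean N \<beta> \<alpha> B F \<le> c"
  using gibbs_mean_mono[OF assms, where \<beta> = \<beta> and \<alpha> = \<alpha>] by simp

lemma gibbs_mean_ge_const:
  assumes "three_blocks N n B" "\<And>v. (\<And>k. \<bar>v $ k\<bar> \<le> 1) \<Longrightarrow> c \<le> F v"
  shows "c \<le> gibbs_mean N \<beta> \<alpha> B F"
  using gibbs_mean_mono[OF assms, where \<beta> = \<beta> and \<alpha> = \<alpha>] by simp

text \<open>
  All statements about the interacting model are reduced to the decoupled one, \<open>\<alpha> = 0\<close>, by
  treating the interaction as a density. Since \<open>|B\<^sub>1| = |B\<^sub>3|\<close>, the middle block only sees the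
  sum of the two outer magnetizations.
\<close>

definition coupling :: "real \<Rightarrow> real ^ 3 \<Rightarrow> real" where
  "coupling J v = J * v $ 2 * (v $ 1 + v $ 3)"

definition strength :: "real \<Rightarrow> (3 \<Rightarrow> nat set) \<Rightarrow> real" where
  "strength \<alpha> B = \<alpha> * sqrt (real (card (B 1)) * real (card (B 2)))"

lemma exp_hamiltonian:
  assumes "three_blocks N n B"
  shows "exp (- hamiltonian \<beta> \<alpha> B \<sigma>) =
    exp (- hamiltonian \<beta> 0 B \<sigma>) * exp (coupling (strength \<alpha> B) (magnetization B \<sigma>))"
  unfolding exp_add[symmetric]
  by (simp add: hamiltonian_def Let_def coupling_def strength_def three_blocksD(5)[OF assms]
      algebra_simps)

lemma gibbs_mean_tilt:
  assumes "three_blocks N n B"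
  shows "gibbs_mean N \<beta> \<alpha> B F =
    gibbs_mean N \<beta> 0 B (\<lambda>v. exp (coupling (strength \<alpha> B) v) * F v) /
    gibbs_mean N \<beta> 0 B (\<lambda>v. exp (coupling (strength \<alpha> B) v))"
  unfolding gibbs_mean_def exp_hamiltonian[OF assms, of \<beta> \<alpha>]
  using boltzmann_sum_pos[of \<beta> 0 B N] by (simp add: mult.assoc)

section \<open>The decoupled model\<close>

lemma exp_hamiltonian_zero:
  "exp (- hamiltonian \<beta> 0 B \<sigma>) = (\<Prod>k\<in>UNIV. cw_weight \<beta> (B k) \<sigma>)"
  by (simp add: hamiltonian_def Let_def cw_weight_def magnetization_nth exp_sum)

lemma block_mean_cong:
  "(\<And>i. i \<in> A \<Longrightarrow> \<sigma> i = \<tau> i) \<Longrightarrow> block_mean A \<sigma> = block_mean A \<tau>"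
  by (simp add: block_mean_def)

lemma cw_weight_cong:
  "(\<And>i. i \<in> A \<Longrightarrow> \<sigma> i = \<tau> i) \<Longrightarrow> cw_weight \<beta> A \<sigma> = cw_weight \<beta> A \<tau>"
  using block_mean_cong[of A \<sigma> \<tau>] by (simp add: cw_weight_def)

lemma sum_spins_split:
  assumes "A \<subseteq> I"
  shows "(\<Sum>\<sigma>\<in>spins I. f \<sigma>) =
    (\<Sum>\<tau>\<in>spins (I - A). \<Sum>\<rho>\<in>spins A. f (\<lambda>i. if i \<in> A then \<rho> i else \<tau> i))"
proof -
  define cut where "cut = (\<lambda>\<sigma> :: nat \<Rightarrow> real. (restrict \<sigma> (I - A), restrict \<sigma> A))"
  define merge where "merge = (\<lambda>(\<tau>, \<rho>) i. if i \<in> A then \<rho> i else \<tau> i :: real)"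
  have merge_cut: "merge (cut \<sigma>) = \<sigma>" if "\<sigma> \<in> spins I" for \<sigma>
    using that by (auto simp: merge_def cut_def spins_def PiE_def extensional_def fun_eq_iff)
  have "(\<Sum>\<sigma>\<in>spins I. f \<sigma>) = (\<Sum>p\<in>spins (I - A) \<times> spins A. f (merge p))"
  proof (rule sum.reindex_bij_witness[of _ merge cut])
    fix \<sigma> assume \<sigma>: "\<sigma> \<in> spins I"
    show "cut \<sigma> \<in> spins (I - A) \<times> spins A"
      using \<sigma> assms unfolding cut_def spins_def by (auto simp: PiE_iff)
  next
    fix p assume p: "p \<in> spins (I - A) \<times> spins A"
    show "cut (merge p) = p"
      using p by (auto simp: cut_def merge_def spins_def PiE_iff extensional_def fun_eq_iff)
    show "merge p \<in> spins I"
      using p assms by (auto simp: merge_def spins_def PiE_iff extensional_def) blast+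
  qed (simp_all add: merge_cut)
  then show ?thesis
    by (simp add: sum.cartesian_product merge_def case_prod_beta)
qed

text \<open>
  A comparison of weights in one block carries over to the whole system, as the factors of the
  other blocks are constant while the spins of this block are summed.
\<close>

lemma sum_spins_marginal_le:
  assumes "A \<subseteq> I"
    and F: "\<And>\<sigma> \<tau>. (\<And>i. i \<in> A \<Longrightarrow> \<sigma> i = \<tau> i) \<Longrightarrow> F \<sigma> = F \<tau>"
    and G: "\<And>\<sigma> \<tau>. (\<And>i. i \<in> A \<Longrightarrow> \<sigma> i = \<tau> i) \<Longrightarrow> G \<sigma> = G \<tau>"
    and R: "\<And>\<sigma> \<tau>. (\<And>i. i \<notin> A \<Longrightarrow> \<sigma> i = \<tau> i) \<Longrightarrow> R \<sigma> = R \<tau>"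
    and R_nonneg: "\<And>\<sigma>. 0 \<le> R \<sigma>"
    and le: "(\<Sum>\<sigma>\<in>spins A. F \<sigma>) \<le> (c::real) * (\<Sum>\<sigma>\<in>spins A. G \<sigma>)"
  shows "(\<Sum>\<sigma>\<in>spins I. F \<sigma> * R \<sigma>) \<le> c * (\<Sum>\<sigma>\<in>spins I. G \<sigma> * R \<sigma>)"
proof -
  let ?m = "\<lambda>\<tau> \<rho> i. if i \<in> A then \<rho> i else \<tau> i :: real"
  have split: "(\<Sum>\<sigma>\<in>spins I. H \<sigma> * R \<sigma>) = (\<Sum>\<tau>\<in>spins (I - A). R \<tau> * (\<Sum>\<rho>\<in>spins A. H \<rho>))"
    if H: "\<And>\<sigma> \<tau>. (\<And>i. i \<in> A \<Longrightarrow> \<sigma> i = \<tau> i) \<Longrightarrow> H \<sigma> = H \<tau>" for H :: "(nat \<Rightarrow> real) \<Rightarrow> real"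
  proof -
    have "H (?m \<tau> \<rho>) = H \<rho>" "R (?m \<tau> \<rho>) = R \<tau>" for \<tau> \<rho>
      by (rule H, simp) (rule R, simp)
    then show ?thesis
      unfolding sum_spins_split[OF assms(1)] by (simp add: sum_distrib_left mult.commute)
  qed
  have "(\<Sum>\<sigma>\<in>spins I. F \<sigma> * R \<sigma>) \<le> (\<Sum>\<tau>\<in>spins (I - A). R \<tau> * (c * (\<Sum>\<rho>\<in>spins A. G \<rho>)))"
    by (subst split, erule F) (intro sum_mono mult_left_mono le R_nonneg)
  also have "\<dots> = c * (\<Sum>\<sigma>\<in>spins I. G \<sigma> * R \<sigma>)"
    by (subst split, erule G) (simp add: sum_distrib_left mult.left_commute)
  finally show ?thesis .
qed

lemma decoupled_marginal_le:
  assumes blocks: "three_blocks N n B"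
    and le: "(\<Sum>\<sigma>\<in>spins (B k). cw_weight \<beta> (B k) \<sigma> * f (block_mean (B k) \<sigma>))
      \<le> c * (\<Sum>\<sigma>\<in>spins (B k). cw_weight \<beta> (B k) \<sigma> * g (block_mean (B k) \<sigma>))"
  shows "gibbs_mean N \<beta> 0 B (\<lambda>v. f (v $ k)) \<le> c * gibbs_mean N \<beta> 0 B (\<lambda>v. g (v $ k))"
proof -
  let ?R = "\<lambda>\<sigma>. \<Prod>j\<in>- {k}. cw_weight \<beta> (B j) \<sigma>"
  have weight: "exp (- hamiltonian \<beta> 0 B \<sigma>) * h (magnetization B \<sigma> $ k) =
      cw_weight \<beta> (B k) \<sigma> * h (block_mean (B k) \<sigma>) * ?R \<sigma>" for h :: "real \<Rightarrow> real" and \<sigma>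
    unfolding exp_hamiltonian_zero magnetization_nth
    by (subst prod.remove[of _ k]) (auto simp: Compl_eq_Diff_UNIV)
  have "(\<Sum>\<sigma>\<in>spins {1..N}. cw_weight \<beta> (B k) \<sigma> * f (block_mean (B k) \<sigma>) * ?R \<sigma>)
      \<le> c * (\<Sum>\<sigma>\<in>spins {1..N}. cw_weight \<beta> (B k) \<sigma> * g (block_mean (B k) \<sigma>) * ?R \<sigma>)"
  proof (rule sum_spins_marginal_le[OF three_blocksD(2)[OF blocks] _ _ _ _ le])
    fix \<sigma> \<tau> :: "nat \<Rightarrow> real" assume eq: "\<And>i. i \<notin> B k \<Longrightarrow> \<sigma> i = \<tau> i"
    show "?R \<sigma> = ?R \<tau>"
      using three_blocksD(3)[OF blocks] by (intro prod.cong cw_weight_cong eq) auto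
  next
    fix \<sigma> \<tau> :: "nat \<Rightarrow> real" assume eq: "\<And>i. i \<in> B k \<Longrightarrow> \<sigma> i = \<tau> i"
    then have "block_mean (B k) \<sigma> = block_mean (B k) \<tau>" by (rule block_mean_cong)
    then show "cw_weight \<beta> (B k) \<sigma> * f (block_mean (B k) \<sigma>) =
        cw_weight \<beta> (B k) \<tau> * f (block_mean (B k) \<tau>)"
      and "cw_weight \<beta> (B k) \<sigma> * g (block_mean (B k) \<sigma>) =
        cw_weight \<beta> (B k) \<tau> * g (block_mean (B k) \<tau>)"
      by (simp_all add: cw_weight_def)
  qed (auto intro: prod_nonneg simp: cw_weight_def)
  then show ?thesis
    unfolding gibbs_mean_def weight spin_configs_eq
    using boltzmann_sum_pos[of \<beta> 0 B N, unfolded spin_configs_eq]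
    by (simp add: divide_right_mono)
qed

lemma decoupled_far_le:
  assumes "\<beta> > 1" "\<epsilon> > 0"
  shows "\<exists>K>0::real. \<exists>c>0::real. \<forall>N n B k. three_blocks N n B \<longrightarrow>
    gibbs_mean N \<beta> 0 B (\<lambda>v. of_bool (v $ k \<in> far_set \<beta> \<epsilon>)) \<le> K * exp (- c * card (B k))"
proof -
  obtain K c :: real where Kc: "K > 0" "c > 0" "\<forall>A. finite A \<longrightarrow>
    (\<Sum>\<sigma>\<in>spins A. cw_weight \<beta> A \<sigma> * of_bool (block_mean A \<sigma> \<in> far_set \<beta> \<epsilon>))
      \<le> K * exp (- c * card A) * (\<Sum>\<sigma>\<in>spins A. cw_weight \<beta> A \<sigma>)"
    using cw_far_weight_le[OF assms] by (elim exE conjE) (rule that)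
  have "gibbs_mean N \<beta> 0 B (\<lambda>v. of_bool (v $ k \<in> far_set \<beta> \<epsilon>)) \<le> K * exp (- c * card (B k))"
    if blocks: "three_blocks N n B" for N n B k
  proof -
    have "gibbs_mean N \<beta> 0 B (\<lambda>v. of_bool (v $ k \<in> far_set \<beta> \<epsilon>))
        \<le> K * exp (- c * card (B k)) * gibbs_mean N \<beta> 0 B (\<lambda>v. 1)"
      by (rule decoupled_marginal_le[OF blocks, where g = "\<lambda>x. 1"])
         (unfold mult_1_right, rule Kc(3)[rule_format, OF three_blocksD(1)[OF blocks]])
    then show ?thesis unfolding gibbs_mean_const mult_1_right .
  qed
  with Kc(1,2) show ?thesis by (intro exI[of _ K] exI[of _ c] conjI allI impI)
qed

lemma decoupled_aligned_ge:
  assumes "three_blocks N n B" "B k \<noteq> {}" "\<beta> > 1"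
  shows "1 / 2 ^ card (B k) \<le> gibbs_mean N \<beta> 0 B (\<lambda>v. of_bool (v $ k = 1))"
proof -
  have "gibbs_mean N \<beta> 0 B (\<lambda>v. 1)
      \<le> 2 ^ card (B k) * gibbs_mean N \<beta> 0 B (\<lambda>v. of_bool (v $ k = 1))"
    by (rule decoupled_marginal_le[OF assms(1), where f = "\<lambda>x. 1" and g = "\<lambda>x. of_bool (x = 1)"])
       (unfold mult_1_right, rule cw_aligned_weight_ge,
        use assms three_blocksD(1)[OF assms(1)] in simp_all)
  then show ?thesis by (simp add: divide_le_eq mult.commute)
qed

text \<open>
  Each block may be flipped independently. The flips act on the magnetization vector by
  componentwise multiplication with a vector of signs.
\<close>

lemma decoupled_flip:
  assumes blocks: "three_blocks N n B" and \<eta>: "\<And>k. \<eta> $ k \<in> {-1, 1}"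
  shows "gibbs_mean N \<beta> 0 B (\<lambda>v. F (\<eta> * v)) = gibbs_mean N \<beta> 0 B F"
proof -
  define s where "s = (\<lambda>i. if \<exists>k. i \<in> B k then \<eta> $ (THE k. i \<in> B k) else 1)"
  have s_block: "s i = \<eta> $ k" if "i \<in> B k" for i k
  proof -
    have "(THE k. i \<in> B k) = k"
      using that three_blocksD(3)[OF blocks] by (intro the_equality) auto
    with that show ?thesis by (auto simp: s_def)
  qed
  have s_sign: "s i \<in> {-1, 1}" for i using \<eta> by (auto simp: s_def)
  define flip where "flip = (\<lambda>\<sigma>. \<lambda>i\<in>{1..N}. s i * \<sigma> i)"
  have flip_in: "flip \<sigma> \<in> spin_configs N" if "\<sigma> \<in> spin_configs N" for \<sigma>
  proof -
    have "s i * \<sigma> i \<in> {-1, 1}" if "i \<in> {1..N}" for i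
    proof -
      have "\<sigma> i \<in> {-1, 1}" using \<open>\<sigma> \<in> spin_configs N\<close> that by (simp add: spin_configs_def PiE_iff)
      with s_sign[of i] show ?thesis by auto
    qed
    then show ?thesis unfolding flip_def spin_configs_def by (rule restrict_PiE_iff[THEN iffD2, rule_format])
  qed
  have flip_flip: "flip (flip \<sigma>) = \<sigma>" if "\<sigma> \<in> spin_configs N" for \<sigma>
  proof
    fix i
    have "s i * (s i * \<sigma> i) = \<sigma> i" using s_sign[of i] by auto
    then show "flip (flip \<sigma>) i = \<sigma> i"
      using that by (auto simp: flip_def spin_configs_def PiE_def extensional_def)
  qed
  have mean: "block_mean (B k) (flip \<sigma>) = \<eta> $ k * block_mean (B k) \<sigma>" for k \<sigma>
  proof -
    have "(\<Sum>i\<in>B k. flip \<sigma> i) = (\<Sum>i\<in>B k. \<eta> $ k * \<sigma> i)"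
      using three_blocksD(2)[OF blocks, of k] by (intro sum.cong) (auto simp: flip_def s_block)
    then show ?thesis by (simp add: block_mean_def sum_distrib_left)
  qed
  have mag: "magnetization B (flip \<sigma>) = \<eta> * magnetization B \<sigma>" for \<sigma>
    by (simp add: vec_eq_iff magnetization_nth mean)
  have "(\<eta> $ k)\<^sup>2 = 1" for k using \<eta>[of k] by auto
  then have weight: "exp (- hamiltonian \<beta> 0 B (flip \<sigma>)) = exp (- hamiltonian \<beta> 0 B \<sigma>)" for \<sigma>
    by (simp add: exp_hamiltonian_zero cw_weight_def mean power_mult_distrib)
  have "(\<Sum>\<sigma>\<in>spin_configs N. exp (- hamiltonian \<beta> 0 B \<sigma>) * F (\<eta> * magnetization B \<sigma>)) =
      (\<Sum>\<sigma>\<in>spin_configs N. exp (- hamiltonian \<beta> 0 B \<sigma>) * F (magnetization B \<sigma>))"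
    by (rule sum.reindex_bij_witness[where i = flip and j = flip])
       (simp_all add: flip_in flip_flip mag weight)
  then show ?thesis by (simp add: gibbs_mean_def)
qed

lemma gibbs_mean_flip:
  assumes blocks: "three_blocks N n B" and \<eta>: "\<And>k. \<eta> $ k \<in> {-1, 1}"
    and sym: "\<And>v. coupling (strength \<alpha> B) (\<eta> * v) = coupling (strength \<alpha> B) v"
  shows "gibbs_mean N \<beta> \<alpha> B (\<lambda>v. F (\<eta> * v)) = gibbs_mean N \<beta> \<alpha> B F"
  using decoupled_flip[OF blocks \<eta>, of \<beta> "\<lambda>v. exp (coupling (strength \<alpha> B) v) * F v"]
  by (simp add: gibbs_mean_tilt[OF blocks, of \<beta> \<alpha>] sym)

definition sign_vectors :: "(real ^ 3) list" where
  "sign_vectors = [vector [\<chi>\<^sub>1, \<chi>\<^sub>2, \<chi>\<^sub>3]. \<chi>\<^sub>1 \<leftarrow> [-1, 1], \<chi>\<^sub>2 \<leftarrow> [-1, 1], \<chi>\<^sub>3 \<leftarrow> [-1, 1]]"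

lemma times_vector_3:
  "vector [a, b, c] * v = (vector [a * v $ 1, b * v $ 2, c * v $ 3] :: real ^ 3)"
  by (simp add: vec_eq_iff forall_3)

lemma set_sign_vectors:
  "set sign_vectors = (\<lambda>(a, b, c). vector [a, b, c]) ` ({-1, 1} \<times> {-1, 1} \<times> {-1, 1})"
  by (auto simp: sign_vectors_def)

lemma sign_vectors_signs: "\<eta> \<in> set sign_vectors \<Longrightarrow> \<eta> $ k \<in> {-1, 1}"
  using exhaust_3[of k] by (auto simp: set_sign_vectors)

lemma some_flip_positive:
  "\<exists>\<eta>\<in>set sign_vectors. \<forall>k. (\<eta> * v) $ k = \<bar>v $ k\<bar>"
proof -
  define s where "s = (\<lambda>x::real. if x < 0 then -1 else 1 :: real)"
  have "vector [s (v $ 1), s (v $ 2), s (v $ 3)] \<in> set sign_vectors"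
    unfolding set_sign_vectors by (rule image_eqI[of _ _ "(s (v $ 1), s (v $ 2), s (v $ 3))"]) (auto simp: s_def)
  moreover have "\<forall>k. (vector [s (v $ 1), s (v $ 2), s (v $ 3)] * v) $ k = \<bar>v $ k\<bar>"
    by (auto simp: forall_3 s_def)
  ultimately show ?thesis by blast
qed
lemma sign_vectors_translate:
  "\<eta>\<^sub>0 \<in> set sign_vectors \<Longrightarrow> (\<Sum>\<eta>\<leftarrow>sign_vectors. F (\<eta> * \<eta>\<^sub>0)) = (\<Sum>\<eta>\<leftarrow>sign_vectors. F \<eta> :: real)"
  unfolding set_sign_vectors by (auto simp: sign_vectors_def times_vector_3)

text \<open>
  Every configuration of signs of the three magnetizations has the same probability, hence the
  all-positive one has at least one eighth of the mass.
\<close>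

lemma decoupled_positive_ge:
  assumes blocks: "three_blocks N n B"
  shows "gibbs_mean N \<beta> 0 B (\<lambda>v. of_bool (\<forall>k. P k \<bar>v $ k\<bar>))
    \<le> 8 * gibbs_mean N \<beta> 0 B (\<lambda>v. of_bool (\<forall>k. P k (v $ k)))"
proof -
  have "gibbs_mean N \<beta> 0 B (\<lambda>v. of_bool (\<forall>k. P k \<bar>v $ k\<bar>))
      \<le> gibbs_mean N \<beta> 0 B (\<lambda>v. \<Sum>\<eta>\<leftarrow>sign_vectors. of_bool (\<forall>k. P k ((\<eta> * v) $ k)))"
  proof (rule gibbs_mean_mono[OF blocks])
    fix v :: "real ^ 3"
    obtain \<eta> where \<eta>: "\<eta> \<in> set sign_vectors" "\<And>k. (\<eta> * v) $ k = \<bar>v $ k\<bar>"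
      using some_flip_positive[of v] by blast
    have "of_bool (\<forall>k. P k \<bar>v $ k\<bar>) = (of_bool (\<forall>k. P k ((\<eta> * v) $ k)) :: real)"
      unfolding \<eta>(2) by (rule refl)
    also have "\<dots> \<le> (\<Sum>\<eta>\<leftarrow>sign_vectors. of_bool (\<forall>k. P k ((\<eta> * v) $ k)))"
      using \<eta>(1) by (intro member_le_sum_list) auto
    finally show "of_bool (\<forall>k. P k \<bar>v $ k\<bar>)
        \<le> (\<Sum>\<eta>\<leftarrow>sign_vectors. of_bool (\<forall>k. P k ((\<eta> * v) $ k)) :: real)" .
  qed
  also have "\<dots> = (\<Sum>\<eta>\<leftarrow>sign_vectors.
      gibbs_mean N \<beta> 0 B (\<lambda>v. of_bool (\<forall>k. P k (v $ k))))"
    unfolding gibbs_mean_sum_list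
    by (intro arg_cong[where f = sum_list] map_cong refl
          decoupled_flip[OF blocks, where F = "\<lambda>v. of_bool (\<forall>k. P k (v $ k))"]
          sign_vectors_signs)
  also have "\<dots> = 8 * gibbs_mean N \<beta> 0 B (\<lambda>v. of_bool (\<forall>k. P k (v $ k)))"
    by (simp add: sum_list_triv) (simp add: sign_vectors_def)
  finally show ?thesis .
qed

section \<open>Weak convergence from concentration up to symmetry\<close>

lemma integral_dirac_average:
  fixes f :: "'a::topological_space \<Rightarrow> real"
  assumes "xs \<noteq> []" "f \<in> borel_measurable borel"
  shows "(\<integral>x. f x \<partial>dirac_average xs) = (\<Sum>x\<leftarrow>xs. f x) / length xs"
proof -
  let ?n = "length xs"
  let ?P = "pmf_of_set {..<?n}"
  have ne: "{..<?n} \<noteq> {}" using assms(1) by auto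
  have "dirac_average xs = distr (measure_pmf ?P) borel (\<lambda>i. xs ! i)"
  proof (rule measure_eqI)
    fix A assume "A \<in> sets (dirac_average xs)"
    then have A: "A \<in> sets borel" by simp
    let ?C = "{..<?n} \<inter> (\<lambda>i. xs ! i) -` A"
    have "(\<Sum>x\<leftarrow>xs. emeasure (return borel x) A) = (\<Sum>i\<in>{..<?n}. indicator ?C i)"
      using A by (simp add: sum_list_sum_nth atLeast0LessThan indicator_def)
    also have "\<dots> = of_nat (card ?C)"
      by (simp add: indicator_def sum.If_cases vimage_def)
    finally show "emeasure (dirac_average xs) A =
        emeasure (distr (measure_pmf ?P) borel (\<lambda>i. xs ! i)) A"
      using ne A assms(1) by (simp add: emeasure_dirac_average emeasure_distr emeasure_pmf_of_set
          divide_ennreal ennreal_of_nat_eq_real_of_nat)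
  qed simp
  then have "(\<integral>x. f x \<partial>dirac_average xs) = (\<integral>i. f (xs ! i) \<partial>measure_pmf ?P)"
    using assms(2) by (simp add: integral_distr)
  then show ?thesis
    using ne by (simp add: integral_pmf_of_set sum_list_sum_nth atLeast0LessThan)
qed

text \<open>
  If the law is invariant under a group of sign changes, the test function may be averaged over
  the group. It then takes the same value near all points of the orbit of \<open>p\<close>, so it suffices
  that the magnetization is close to this orbit: the invariance distributes the mass evenly.
\<close>

lemma gibbs_mean_tendsto_orbit_average:
  fixes f :: "real ^ 3 \<Rightarrow> real" and G :: "(real ^ 3) list"
  assumes blocks: "\<forall>\<^sub>F N in F. three_blocks N (n N) (B N)"
    and cont: "continuous_on UNIV f" and bdd: "bounded (range f)"
    and ne: "G \<noteq> []"
    and group: "\<And>s h. s \<in> set G \<Longrightarrow> (\<Sum>t\<leftarrow>G. h (t * s)) = (\<Sum>t\<leftarrow>G. h t :: real)"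
    and inv: "\<forall>\<^sub>F N in F. \<forall>s\<in>set G.
      gibbs_mean N \<beta> (\<alpha> N) (B N) (\<lambda>v. f (s * v)) = gibbs_mean N \<beta> (\<alpha> N) (B N) f"
    and conc: "\<And>\<epsilon>. \<epsilon> > 0 \<Longrightarrow>
      ((\<lambda>N. gibbs_mean N \<beta> (\<alpha> N) (B N) (\<lambda>v. of_bool (\<forall>s\<in>set G. \<epsilon> \<le> dist (s * v) p))) \<longlongrightarrow> 0) F"
  shows "((\<lambda>N. gibbs_mean N \<beta> (\<alpha> N) (B N) f) \<longlongrightarrow> (\<Sum>s\<leftarrow>G. f (s * p)) / length G) F"
proof -
  define g where "g = (\<lambda>v. (\<Sum>s\<leftarrow>G. f (s * v)) / length G)"
  obtain M where M: "M > 0" "\<And>v. \<bar>f v\<bar> \<le> M" using bdd by (auto simp: bounded_pos)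
  have len: "real (length G) > 0" using ne by simp
  have g_inv: "g (s * v) = g v" if "s \<in> set G" for s v
    using group[OF that, of "\<lambda>t. f (t * v)"] by (simp add: g_def mult.assoc)
  have g_bound: "\<bar>g v\<bar> \<le> M" for v
  proof -
    have "\<bar>\<Sum>s\<leftarrow>G. f (s * v)\<bar> \<le> length G * M" for G
      by (induction G)
         (use M(2) in \<open>auto simp: algebra_simps intro!: order_trans[OF abs_triangle_ineq] add_mono\<close>)
    then show ?thesis using len by (simp add: g_def divide_le_eq mult.commute)
  qed
  have "isCont (\<lambda>v. \<Sum>s\<leftarrow>G. f (s * v)) p" for G
  proof (induction G)
    case (Cons s G)
    have "linear (\<lambda>v::real^3. s * v)" by (rule linearI) (simp_all add: vec_eq_iff algebra_simps)
    then have "isCont (\<lambda>v::real^3. s * v) p"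
      by (simp add: linear_continuous_at linear_conv_bounded_linear)
    moreover have "isCont f (s * p)" using cont by (simp add: continuous_on_eq_continuous_at)
    ultimately have "isCont (\<lambda>v. f (s * v)) p" by (rule isCont_o2)
    with Cons show ?case by simp
  qed simp
  then have g_cont: "isCont g p" unfolding g_def using len by (intro continuous_intros) auto
  have "((\<lambda>N. gibbs_mean N \<beta> (\<alpha> N) (B N) g) \<longlongrightarrow> g p) F"
  proof (rule tendstoI)
    fix e :: real assume "e > 0"
    obtain \<epsilon> where \<epsilon>: "\<epsilon> > 0" "\<And>v. dist v p < \<epsilon> \<Longrightarrow> \<bar>g v - g p\<bar> < e / 2"
      using g_cont \<open>e > 0\<close> unfolding continuous_at_eps_delta dist_real_def
      by (metis half_gt_zero)
    let ?bad = "\<lambda>v. of_bool (\<forall>s\<in>set G. \<epsilon> \<le> dist (s * v) p) :: real"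
    have close: "\<bar>g v - g p\<bar> \<le> e / 2 + 2 * M * ?bad v" for v
    proof (cases "\<forall>s\<in>set G. \<epsilon> \<le> dist (s * v) p")
      case True
      then show ?thesis using g_bound[of v] g_bound[of p] \<open>e > 0\<close> by simp
    next
      case False
      then obtain s where s: "s \<in> set G" "dist (s * v) p < \<epsilon>" by auto
      with \<epsilon>(2)[OF s(2)] show ?thesis using g_inv[OF s(1), of v] False M(1) by auto
    qed
    have "\<forall>\<^sub>F N in F. gibbs_mean N \<beta> (\<alpha> N) (B N) ?bad < e / (4 * M)"
      using conc[OF \<epsilon>(1)] \<open>e > 0\<close> M(1) by (intro order_tendstoD(2)) auto
    with blocks show "\<forall>\<^sub>F N in F. dist (gibbs_mean N \<beta> (\<alpha> N) (B N) g) (g p) < e"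
    proof eventually_elim
      case (elim N)
      let ?E = "gibbs_mean N \<beta> (\<alpha> N) (B N)"
      have "?E g - g p = ?E (\<lambda>v. g v - g p)" by (simp add: gibbs_mean_diff)
      also have "\<dots> \<le> ?E (\<lambda>v. e / 2 + 2 * M * ?bad v)"
        by (rule gibbs_mean_mono[OF elim(1)]) (use close in \<open>auto simp: abs_le_iff\<close>)
      finally have upper: "?E g - g p \<le> e / 2 + 2 * M * ?E ?bad"
        by (simp only: gibbs_mean_add gibbs_mean_cmult gibbs_mean_const)
      have "g p - ?E g = ?E (\<lambda>v. g p - g v)" by (simp add: gibbs_mean_diff)
      also have "\<dots> \<le> ?E (\<lambda>v. e / 2 + 2 * M * ?bad v)"
        by (rule gibbs_mean_mono[OF elim(1)]) (use close in \<open>auto simp: abs_le_iff\<close>)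
      finally have lower: "g p - ?E g \<le> e / 2 + 2 * M * ?E ?bad"
        by (simp only: gibbs_mean_add gibbs_mean_cmult gibbs_mean_const)
      have "2 * M * ?E ?bad < e / 2"
        using elim(2) M(1) by (simp add: field_simps)
      with upper lower show ?case by (simp only: dist_real_def abs_less_iff) linarith
    qed
  qed
  moreover have "\<forall>\<^sub>F N in F. gibbs_mean N \<beta> (\<alpha> N) (B N) g = gibbs_mean N \<beta> (\<alpha> N) (B N) f"
    using inv
  proof eventually_elim
    case (elim N)
    let ?E = "gibbs_mean N \<beta> (\<alpha> N) (B N)"
    have "?E g = (\<Sum>s\<leftarrow>G. ?E (\<lambda>v. f (s * v))) / length G"
      using gibbs_mean_cmult[of N \<beta> "\<alpha> N" "B N" "1 / length G" "\<lambda>v. \<Sum>s\<leftarrow>G. f (s * v)"]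
      by (simp add: g_def gibbs_mean_sum_list)
    also have "(\<Sum>s\<leftarrow>G. ?E (\<lambda>v. f (s * v))) = (\<Sum>s\<leftarrow>G. ?E f)"
      using elim by (intro arg_cong[where f = sum_list] map_cong) auto
    finally show ?case using len by (simp add: sum_list_triv)
  qed
  ultimately show ?thesis unfolding g_def by (simp cong: tendsto_cong)
qed

section \<open>Estimates for the interacting model\<close>

text \<open>
  An unlikely event is compared with an event \<open>A\<close> on which the interaction is at least \<open>l\<close>: the
  latter bounds the normalisation of the density from below.
\<close>

lemma gibbs_mean_bad_le:
  assumes blocks: "three_blocks N n B"
    and A: "g \<le> gibbs_mean N \<beta> 0 B (\<lambda>v. of_bool (A v))" "g > 0"
    and on_A: "\<And>v. (\<And>k. \<bar>v $ k\<bar> \<le> 1) \<Longrightarrow> A v \<Longrightarrow> l \<le> coupling (strength \<alpha> B) v"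
    and bad: "\<And>v. (\<And>k. \<bar>v $ k\<bar> \<le> 1) \<Longrightarrow> bad v \<Longrightarrow> exp (coupling (strength \<alpha> B) v) \<le> R v"
    and R: "\<And>v. 0 \<le> R v"
  shows "gibbs_mean N \<beta> \<alpha> B (\<lambda>v. of_bool (bad v)) \<le> gibbs_mean N \<beta> 0 B R / (g * exp l)"
proof -
  let ?E = "gibbs_mean N \<beta> 0 B" and ?w = "\<lambda>v. exp (coupling (strength \<alpha> B) v)"
  have "g * exp l \<le> exp l * ?E (\<lambda>v. of_bool (A v))" using A by simp
  also have "\<dots> \<le> ?E ?w"
    unfolding gibbs_mean_cmult[symmetric]
    by (rule gibbs_mean_mono[OF blocks]) (use on_A in auto)
  finally have "g * exp l \<le> ?E ?w" .
  moreover have "?E (\<lambda>v. ?w v * of_bool (bad v)) \<le> ?E R"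
    by (rule gibbs_mean_mono[OF blocks]) (use bad R in auto)
  moreover have "0 \<le> ?E R" by (intro gibbs_mean_nonneg R)
  ultimately show ?thesis
    unfolding gibbs_mean_tilt[OF blocks, of \<beta> \<alpha>] using A(2) by (intro frac_le) auto
qed

lemma coupling_le:
  assumes "\<And>k. \<bar>v $ k\<bar> \<le> 1" "0 \<le> J"
  shows "\<bar>coupling J v\<bar> \<le> 2 * J"
proof -
  have "\<bar>v $ 2\<bar> * \<bar>v $ 1 + v $ 3\<bar> \<le> 1 * 2"
    using assms(1)[of 1] assms(1)[of 2] assms(1)[of 3] by (intro mult_mono) auto
  then have "J * (\<bar>v $ 2\<bar> * \<bar>v $ 1 + v $ 3\<bar>) \<le> J * (1 * 2)"
    using assms(2) by (rule mult_left_mono)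
  then show ?thesis using assms(2) by (simp add: coupling_def abs_mult)
qed

text \<open>A small interaction changes expectations only by a small relative amount.\<close>

lemma gibbs_mean_close_to_decoupled:
  assumes blocks: "three_blocks N n B" and J: "0 \<le> strength \<alpha> B"
    and f: "\<And>v. \<bar>f v\<bar> \<le> M"
  shows "\<bar>gibbs_mean N \<beta> \<alpha> B f - gibbs_mean N \<beta> 0 B f\<bar> \<le> M * (exp (4 * strength \<alpha> B) - 1)"
proof -
  let ?J = "strength \<alpha> B" and ?E = "gibbs_mean N \<beta> 0 B"
  let ?w = "\<lambda>v. exp (coupling ?J v)"
  define a where "a = ?E ?w"
  have w: "exp (- (2 * ?J)) \<le> ?w v" "?w v \<le> exp (2 * ?J)" if "\<And>k. \<bar>v $ k\<bar> \<le> 1" for v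
    using coupling_le[OF that J] by auto
  have a: "exp (- (2 * ?J)) \<le> a" "a \<le> exp (2 * ?J)"
    unfolding a_def by (rule gibbs_mean_ge_const[OF blocks] gibbs_mean_le_const[OF blocks]; use w in blast)+
  have a_pos: "a > 0" using a(1) exp_gt_zero less_le_trans by blast
  have "M \<ge> 0" using f[of 0] by linarith
  have ratio: "\<bar>?w v / a - 1\<bar> \<le> exp (4 * ?J) - 1" if v: "\<And>k. \<bar>v $ k\<bar> \<le> 1" for v
  proof -
    have "?w v / a \<le> exp (2 * ?J) / exp (- (2 * ?J))"
      using w[OF v] a by (intro frac_le) auto
    then have up: "?w v / a \<le> exp (4 * ?J)" by (simp add: exp_diff[symmetric])
    have "exp (- (2 * ?J)) / exp (2 * ?J) \<le> ?w v / a"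
      using w[OF v] a a_pos by (intro frac_le) auto
    then have low: "exp (- (4 * ?J)) \<le> ?w v / a" by (simp add: exp_diff[symmetric])
    have "1 + 4 * ?J \<le> exp (4 * ?J)" "1 + - (4 * ?J) \<le> exp (- (4 * ?J))"
      by (rule exp_ge_add_one_self)+
    with up low show ?thesis by linarith
  qed
  have diff: "gibbs_mean N \<beta> \<alpha> B f - ?E f = ?E (\<lambda>v. (?w v / a - 1) * f v)"
    using gibbs_mean_cmult[of N \<beta> 0 B "1 / a" "\<lambda>v. ?w v * f v"]
    by (simp add: gibbs_mean_tilt[OF blocks, of \<beta> \<alpha>] left_diff_distrib gibbs_mean_diff a_def)
  have bound: "\<bar>(?w v / a - 1) * f v\<bar> \<le> M * (exp (4 * ?J) - 1)"
    if v: "\<And>k. \<bar>v $ k\<bar> \<le> 1" for v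
    unfolding abs_mult mult.commute[of M] using ratio[OF v] f[of v] J by (intro mult_mono) auto
  have "?E (\<lambda>v. (?w v / a - 1) * f v) \<le> M * (exp (4 * ?J) - 1)"
    by (rule gibbs_mean_le_const[OF blocks]) (use bound in \<open>auto simp: abs_le_iff\<close>)
  moreover have "- (M * (exp (4 * ?J) - 1)) \<le> ?E (\<lambda>v. (?w v / a - 1) * f v)"
    by (rule gibbs_mean_ge_const[OF blocks]) (use bound in \<open>force simp: abs_le_iff\<close>)
  ultimately show ?thesis unfolding diff by (simp add: abs_le_iff)
qed

lemma dist_vector_3_le:
  "dist (s * v) (vector [a, b, c] :: real ^ 3)
    \<le> \<bar>s $ 1 * v $ 1 - a\<bar> + \<bar>s $ 2 * v $ 2 - b\<bar> + \<bar>s $ 3 * v $ 3 - c\<bar>"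
  using norm_le_l1_cart[of "s * v - vector [a, b, c]"] by (simp add: dist_norm sum_3)

lemma near_m_star:
  assumes "x \<notin> far_set \<beta> \<eta>" "\<bar>x\<bar> \<le> 1"
  shows "\<bar>\<bar>x\<bar> - m_star \<beta>\<bar> < \<eta>"
  using assms by (simp add: far_set_def)

text \<open>
  Two outer magnetizations near \<open>\<plusminus> m\<^sup>*\<close> either agree in sign or exert a negligible field on the
  middle block.
\<close>

lemma outer_signs_cases:
  fixes x z :: real
  assumes "\<bar>\<bar>x\<bar> - m\<bar> < \<eta>" "\<bar>\<bar>z\<bar> - m\<bar> < \<eta>"
  obtains "\<bar>x + z\<bar> \<le> 2 * \<eta>"
  | s where "s \<in> {-1, 1 :: real}" "\<bar>s * x - m\<bar> < \<eta>" "\<bar>s * z - m\<bar> < \<eta>"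
proof (cases "x * z \<le> 0")
  case True
  then have "(x \<ge> 0 \<and> z \<le> 0) \<or> (x \<le> 0 \<and> z \<ge> 0)" by (auto simp: mult_le_0_iff)
  then have "\<bar>x + z\<bar> \<le> 2 * \<eta>" using assms by linarith
  then show thesis by (rule that(1))
next
  case False
  then have "(x > 0 \<and> z > 0) \<or> (x < 0 \<and> z < 0)" by (auto simp: not_le zero_less_mult_iff)
  then show thesis
  proof
    assume "x > 0 \<and> z > 0"
    then show thesis using assms by (intro that(2)[of 1]) auto
  next
    assume "x < 0 \<and> z < 0"
    then show thesis using assms by (intro that(2)[of "- 1"]) auto
  qed
qed

lemma coupling_small_field:
  assumes "\<bar>v $ 1 + v $ 3\<bar> \<le> 2 * \<eta>" "\<bar>v $ 2\<bar> \<le> 1" "0 \<le> J"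
  shows "coupling J v \<le> 2 * J * \<eta>"
proof -
  have "v $ 2 * (v $ 1 + v $ 3) \<le> \<bar>v $ 2\<bar> * \<bar>v $ 1 + v $ 3\<bar>"
    by (simp flip: abs_mult)
  also have "\<dots> \<le> 1 * (2 * \<eta>)" using assms by (intro mult_mono) auto
  finally have "J * (v $ 2 * (v $ 1 + v $ 3)) \<le> J * (1 * (2 * \<eta>))"
    using assms(3) by (rule mult_left_mono)
  then show ?thesis by (simp add: coupling_def)
qed

lemma coupling_sign:
  assumes "s \<in> {-1, 1}"
  shows "coupling J v = J * (s * v $ 2) * (s * v $ 1 + s * v $ 3)"
  using assms by (auto simp: coupling_def algebra_simps)

lemma vec_minus_one_times: "vec (- 1) * v = (- v :: real ^ 3)"
  by (simp add: vec_eq_iff)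

text \<open>
  When all three magnetizations are near \<open>\<plusminus> m\<^sup>*\<close> but do not all have the same sign, either the
  outer blocks cancel, or the middle block points against both of them.
\<close>

lemma weak_field_coupling_bound:
  assumes v: "\<And>k. \<bar>v $ k\<bar> \<le> 1" and J: "0 \<le> J" and \<eta>: "0 < \<eta>" "3 * \<eta> \<le> \<epsilon>" "\<eta> < m_star \<beta>"
    and near: "\<And>k. v $ k \<notin> far_set \<beta> \<eta>"
    and away: "\<epsilon> \<le> dist v (vector [m_star \<beta>, m_star \<beta>, m_star \<beta>])"
      "\<epsilon> \<le> dist (- v) (vector [m_star \<beta>, m_star \<beta>, m_star \<beta>])"
  shows "coupling J v \<le> 2 * J * \<eta>"
proof -
  let ?m = "m_star \<beta>"
  have n: "\<bar>\<bar>v $ k\<bar> - ?m\<bar> < \<eta>" for k using near v by (rule near_m_star)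
  from n[of 1] n[of 3] show ?thesis
  proof (cases rule: outer_signs_cases)
    case 1
    then show ?thesis using v J by (intro coupling_small_field)
  next
    case (2 s)
    have "\<epsilon> \<le> dist (vec s * v) (vector [?m, ?m, ?m])"
      using 2(1) away by (auto simp: vec_minus_one_times)
    also have "\<dots> \<le> \<bar>s * v $ 1 - ?m\<bar> + \<bar>s * v $ 2 - ?m\<bar> + \<bar>s * v $ 3 - ?m\<bar>"
      using dist_vector_3_le[of "vec s" v ?m ?m ?m] by simp
    finally have "\<eta> < \<bar>s * v $ 2 - ?m\<bar>" using 2 \<eta> by linarith
    then have "s * v $ 2 \<le> 0" using n[of 2] 2(1) by auto
    moreover have "0 \<le> s * v $ 1 + s * v $ 3" using 2 \<eta> by linarith
    ultimately have "(s * v $ 2) * (s * v $ 1 + s * v $ 3) \<le> 0"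
      by (rule mult_nonpos_nonneg)
    then have "coupling J v \<le> 0"
      unfolding coupling_sign[OF 2(1), of J v] using J
      by (simp add: mult.assoc mult_nonneg_nonpos)
    then show ?thesis using J \<eta> by (smt (verit) mult_nonneg_nonneg)
  qed
qed

text \<open>
  The middle magnetization is unrestricted here. If the outer blocks agree, being away from the
  limit point forces the middle magnetization away from full alignment.
\<close>

lemma strong_field_coupling_bound:
  assumes v: "\<And>k. \<bar>v $ k\<bar> \<le> 1" and J: "0 \<le> J" and \<eta>: "0 < \<eta>" "3 * \<eta> \<le> \<epsilon>" "\<eta> < m_star \<beta>"
    and \<epsilon>: "\<epsilon> \<le> 1"
    and near: "v $ 1 \<notin> far_set \<beta> \<eta>" "v $ 3 \<notin> far_set \<beta> \<eta>"
    and away: "\<epsilon> \<le> dist v (vector [m_star \<beta>, 1, m_star \<beta>])"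
      "\<epsilon> \<le> dist (- v) (vector [m_star \<beta>, 1, m_star \<beta>])"
  shows "coupling J v \<le> 2 * J * max \<eta> ((1 - \<epsilon> / 3) * (m_star \<beta> + \<eta>))"
proof -
  let ?m = "m_star \<beta>" and ?q = "(1 - \<epsilon> / 3) * (m_star \<beta> + \<eta>)"
  from near_m_star[OF near(1) v] near_m_star[OF near(2) v] show ?thesis
  proof (cases rule: outer_signs_cases)
    case 1
    then have "coupling J v \<le> 2 * J * \<eta>" using v J by (intro coupling_small_field)
    also have "\<dots> \<le> 2 * J * max \<eta> ?q" using J by (intro mult_left_mono) auto
    finally show ?thesis .
  next
    case (2 s)
    have "\<epsilon> \<le> dist (vec s * v) (vector [?m, 1, ?m])"
      using 2(1) away by (auto simp: vec_minus_one_times)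
    also have "\<dots> \<le> \<bar>s * v $ 1 - ?m\<bar> + \<bar>s * v $ 2 - 1\<bar> + \<bar>s * v $ 3 - ?m\<bar>"
      using dist_vector_3_le[of "vec s" v ?m 1 ?m] by simp
    finally have "\<epsilon> / 3 \<le> \<bar>s * v $ 2 - 1\<bar>" using 2 \<eta> by linarith
    moreover have "s * v $ 2 \<le> 1" using v[of 2] 2(1) by auto
    ultimately have "s * v $ 2 \<le> 1 - \<epsilon> / 3" by linarith
    moreover have "0 \<le> s * v $ 1 + s * v $ 3" "s * v $ 1 + s * v $ 3 \<le> 2 * (?m + \<eta>)"
      using 2(2,3) \<eta> unfolding abs_less_iff by simp_all
    ultimately have "(s * v $ 2) * (s * v $ 1 + s * v $ 3) \<le> (1 - \<epsilon> / 3) * (2 * (?m + \<eta>))"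
      using \<epsilon> by (intro order_trans[OF mult_right_mono mult_left_mono]) auto
    also have "\<dots> = 2 * ?q" by simp
    also have "\<dots> \<le> 2 * max \<eta> ?q" by simp
    finally have "J * ((s * v $ 2) * (s * v $ 1 + s * v $ 3)) \<le> J * (2 * max \<eta> ?q)"
      using J by (rule mult_left_mono)
    then show ?thesis unfolding coupling_sign[OF 2(1), of J v] by (simp add: mult.assoc)
  qed
qed

section \<open>Concentration\<close>

lemma exp_tendsto_0_of_ratio:
  fixes x g :: "'i \<Rightarrow> real"
  assumes "filterlim x at_top F" "((\<lambda>N. g N / x N) \<longlongrightarrow> l) F" "l < 0"
  shows "((\<lambda>N. exp (g N)) \<longlongrightarrow> 0) F"
proof -
  have "filterlim (\<lambda>N. g N / x N * x N) at_bot F"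
    by (rule filterlim_tendsto_neg_mult_at_bot[OF assms(2,3,1)])
  moreover have "\<forall>\<^sub>F N in F. g N / x N * x N = g N"
    using assms(1)[THEN filterlim_at_top_dense[THEN iffD1], rule_format, of 0]
    by eventually_elim simp
  ultimately have "filterlim g at_bot F" by (simp cong: filterlim_cong)
  then show ?thesis by (rule filterlim_compose[OF exp_at_bot])
qed

definition far_mean :: "nat \<Rightarrow> real \<Rightarrow> (3 \<Rightarrow> nat set) \<Rightarrow> real \<Rightarrow> 3 \<Rightarrow> real" where
  "far_mean N \<beta> B \<eta> k = gibbs_mean N \<beta> 0 B (\<lambda>v. of_bool (v $ k \<in> far_set \<beta> \<eta>))"

lemma far_mean_nonneg: "0 \<le> far_mean N \<beta> B \<eta> k"
  unfolding far_mean_def by (intro gibbs_mean_nonneg) auto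

text \<open>
  The comparison event is that all magnetizations are at least \<open>m\<^sup>* - \<eta>\<close>. Its decoupled
  probability is at least an eighth of that of all blocks being near \<open>\<plusminus> m\<^sup>*\<close>.
\<close>

lemma weak_field_bad_le:
  assumes blocks: "three_blocks N n B" and J: "0 \<le> strength \<alpha> B"
    and \<eta>: "0 < \<eta>" "3 * \<eta> \<le> \<epsilon>" "\<eta> < m_star \<beta>"
    and far: "far_mean N \<beta> B \<eta> 1 + far_mean N \<beta> B \<eta> 2 + far_mean N \<beta> B \<eta> 3 \<le> 1 / 2"
  shows "gibbs_mean N \<beta> \<alpha> B (\<lambda>v. of_bool (\<forall>s\<in>set [1, -1].
        \<epsilon> \<le> dist (s * v) (vector [m_star \<beta>, m_star \<beta>, m_star \<beta>])))
    \<le> 16 * (exp (2 * strength \<alpha> B) *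
          (far_mean N \<beta> B \<eta> 1 + far_mean N \<beta> B \<eta> 2 + far_mean N \<beta> B \<eta> 3)
        + exp (- (2 * strength \<alpha> B * ((m_star \<beta> - \<eta>)\<^sup>2 - \<eta>))))"
proof -
  let ?J = "strength \<alpha> B" and ?m = "m_star \<beta>" and ?E = "gibbs_mean N \<beta> 0 B"
  let ?A = "\<lambda>v :: real ^ 3. \<forall>k. ?m - \<eta> \<le> v $ k"
  let ?far = "\<lambda>k v. of_bool (v $ k \<in> far_set \<beta> \<eta>) :: real"
  let ?bad = "\<lambda>v. \<forall>s\<in>set [1, -1]. \<epsilon> \<le> dist (s * v) (vector [?m, ?m, ?m])"
  let ?R = "\<lambda>v. exp (2 * ?J) * (?far 1 v + ?far 2 v + ?far 3 v) + exp (2 * ?J * \<eta>)"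
  let ?S = "far_mean N \<beta> B \<eta> 1 + far_mean N \<beta> B \<eta> 2 + far_mean N \<beta> B \<eta> 3"
  have "1 - ?S = ?E (\<lambda>v. 1 - (?far 1 v + ?far 2 v + ?far 3 v))"
    by (simp only: far_mean_def gibbs_mean_diff gibbs_mean_add gibbs_mean_const)
  also have "\<dots> \<le> ?E (\<lambda>v. of_bool (\<forall>k. ?m - \<eta> \<le> \<bar>v $ k\<bar>))"
  proof (rule gibbs_mean_mono[OF blocks])
    fix v :: "real ^ 3" assume v: "\<And>k. \<bar>v $ k\<bar> \<le> 1"
    show "1 - (?far 1 v + ?far 2 v + ?far 3 v) \<le> of_bool (\<forall>k. ?m - \<eta> \<le> \<bar>v $ k\<bar>)"
    proof (cases "\<forall>k. v $ k \<notin> far_set \<beta> \<eta>")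
      case True
      then have "?m - \<eta> \<le> \<bar>v $ k\<bar>" for k
        using near_m_star[of "v $ k" \<beta> \<eta>] v[of k] by (simp add: abs_less_iff)
      then show ?thesis by simp
    qed (auto simp: forall_3)
  qed
  also have "\<dots> \<le> 8 * ?E (\<lambda>v. of_bool (?A v))"
    by (rule decoupled_positive_ge[OF blocks, where P = "\<lambda>k x. ?m - \<eta> \<le> x"])
  finally have A: "1 / 16 \<le> ?E (\<lambda>v. of_bool (?A v))" using far by simp
  have "gibbs_mean N \<beta> \<alpha> B (\<lambda>v. of_bool (?bad v))
      \<le> ?E ?R / (1 / 16 * exp (2 * ?J * (?m - \<eta>)\<^sup>2))"
  proof (rule gibbs_mean_bad_le[OF blocks A])
    fix v :: "real ^ 3" assume "?A v"
    then have "(?m - \<eta>) * (2 * (?m - \<eta>)) \<le> v $ 2 * (v $ 1 + v $ 3)"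
      using \<eta> by (intro mult_mono) (auto simp: forall_3)
    then have "?J * ((?m - \<eta>) * (2 * (?m - \<eta>))) \<le> ?J * (v $ 2 * (v $ 1 + v $ 3))"
      using J by (rule mult_left_mono)
    then show "2 * ?J * (?m - \<eta>)\<^sup>2 \<le> coupling ?J v"
      unfolding coupling_def power2_eq_square by (simp only: mult_ac)
  next
    fix v :: "real ^ 3" assume v: "\<And>k. \<bar>v $ k\<bar> \<le> 1" and bad: "?bad v"
    show "exp (coupling ?J v) \<le> ?R v"
    proof (cases "\<forall>k. v $ k \<notin> far_set \<beta> \<eta>")
      case True
      then have "coupling ?J v \<le> 2 * ?J * \<eta>"
        using weak_field_coupling_bound[OF v J \<eta>] bad by simp
      then show ?thesis by (simp add: add_increasing)
    next
      case False
      then have "1 \<le> ?far 1 v + ?far 2 v + ?far 3 v" by (auto simp: forall_3)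
      then have "exp (2 * ?J) * 1 \<le> exp (2 * ?J) * (?far 1 v + ?far 2 v + ?far 3 v)"
        by (rule mult_left_mono) simp
      moreover have "exp (coupling ?J v) \<le> exp (2 * ?J)" using coupling_le[OF v J] by simp
      ultimately show ?thesis using exp_ge_zero[of "2 * ?J * \<eta>"] by linarith
    qed
  qed auto
  also have "?E ?R = exp (2 * ?J) * ?S + exp (2 * ?J * \<eta>)"
    by (simp only: far_mean_def gibbs_mean_add gibbs_mean_cmult gibbs_mean_const)
  also have "(exp (2 * ?J) * ?S + exp (2 * ?J * \<eta>)) / (1 / 16 * exp (2 * ?J * (?m - \<eta>)\<^sup>2)) =
      16 * (exp (2 * ?J) * ?S / exp (2 * ?J * (?m - \<eta>)\<^sup>2) +
        exp (2 * ?J * \<eta>) / exp (2 * ?J * (?m - \<eta>)\<^sup>2))"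
    by (simp only: add_divide_distrib[symmetric] divide_divide_eq_right) simp
  also have "exp (2 * ?J * \<eta>) / exp (2 * ?J * (?m - \<eta>)\<^sup>2) = exp (- (2 * ?J * ((?m - \<eta>)\<^sup>2 - \<eta>)))"
    by (simp add: exp_diff[symmetric] algebra_simps)
  also have "exp (2 * ?J) * ?S / exp (2 * ?J * (?m - \<eta>)\<^sup>2) \<le> exp (2 * ?J) * ?S / 1"
    using J by (intro divide_left_mono) (auto intro!: mult_nonneg_nonneg add_nonneg_nonneg far_mean_nonneg)
  finally show ?thesis by simp
qed

text \<open>
  The comparison event is now a fully aligned middle block, of probability at least
  \<open>1 / 2\<^sup>n\<close>, with outer magnetizations at least \<open>m\<^sup>* - \<eta>\<close>. A union bound gives its probability, because
  the outer blocks fail with a probability that is small even against \<open>1 / 2\<^sup>n\<close>.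
\<close>

lemma strong_field_bad_le:
  assumes blocks: "three_blocks N n B" and J: "0 \<le> strength \<alpha> B" and \<beta>: "\<beta> > 1" and n: "n > 0"
    and \<eta>: "0 < \<eta>" "3 * \<eta> \<le> \<epsilon>" "\<eta> < m_star \<beta>" and \<epsilon>: "\<epsilon> \<le> 1"
    and far: "2 ^ n * (far_mean N \<beta> B \<eta> 1 + far_mean N \<beta> B \<eta> 3) \<le> 1 / 2"
  shows "gibbs_mean N \<beta> \<alpha> B (\<lambda>v. of_bool (\<forall>s\<in>set [1, -1].
        \<epsilon> \<le> dist (s * v) (vector [m_star \<beta>, 1, m_star \<beta>])))
    \<le> 16 * 2 ^ n * (exp (2 * strength \<alpha> B) * (far_mean N \<beta> B \<eta> 1 + far_mean N \<beta> B \<eta> 3)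
        + exp (- (2 * strength \<alpha> B *
            (m_star \<beta> - \<eta> - max \<eta> ((1 - \<epsilon> / 3) * (m_star \<beta> + \<eta>))))))"
proof -
  let ?J = "strength \<alpha> B" and ?m = "m_star \<beta>" and ?E = "gibbs_mean N \<beta> 0 B"
  let ?q = "max \<eta> ((1 - \<epsilon> / 3) * (m_star \<beta> + \<eta>))"
  let ?P = "\<lambda>k x :: real. if k = (2 :: 3) then x = 1 else ?m - \<eta> \<le> x"
  let ?far = "\<lambda>k v. of_bool (v $ k \<in> far_set \<beta> \<eta>) :: real"
  let ?bad = "\<lambda>v. \<forall>s\<in>set [1, -1]. \<epsilon> \<le> dist (s * v) (vector [?m, 1, ?m])"
  let ?R = "\<lambda>v. exp (2 * ?J) * (?far 1 v + ?far 3 v) + exp (2 * ?J * ?q)"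
  let ?S = "far_mean N \<beta> B \<eta> 1 + far_mean N \<beta> B \<eta> 3"
  have "B 2 \<noteq> {}" using n three_blocksD(4)[OF blocks] by auto
  then have "1 / 2 ^ n \<le> ?E (\<lambda>v. of_bool (v $ 2 = 1))"
    using decoupled_aligned_ge[OF blocks, of 2 \<beta>] three_blocksD(4)[OF blocks] \<beta> by simp
  then have "1 / 2 ^ n - ?S \<le> ?E (\<lambda>v. of_bool (v $ 2 = 1) - (?far 1 v + ?far 3 v))"
    by (simp only: far_mean_def gibbs_mean_diff gibbs_mean_add)
  also have "\<dots> \<le> ?E (\<lambda>v. of_bool (\<forall>k. ?P k \<bar>v $ k\<bar>))"
  proof (rule gibbs_mean_mono[OF blocks])
    fix v :: "real ^ 3" assume v: "\<And>k. \<bar>v $ k\<bar> \<le> 1"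
    show "of_bool (v $ 2 = 1) - (?far 1 v + ?far 3 v) \<le> of_bool (\<forall>k. ?P k \<bar>v $ k\<bar>)"
    proof (cases "v $ 1 \<notin> far_set \<beta> \<eta> \<and> v $ 3 \<notin> far_set \<beta> \<eta>")
      case True
      then have "?m - \<eta> \<le> \<bar>v $ 1\<bar>" "?m - \<eta> \<le> \<bar>v $ 3\<bar>"
        using near_m_star[of "v $ 1" \<beta> \<eta>] near_m_star[of "v $ 3" \<beta> \<eta>] v[of 1] v[of 3]
        by (simp_all add: abs_less_iff)
      then show ?thesis by (auto simp: forall_3)
    qed auto
  qed
  also have "\<dots> \<le> 8 * ?E (\<lambda>v. of_bool (\<forall>k. ?P k (v $ k)))"
    by (rule decoupled_positive_ge[OF blocks])
  finally have "2 ^ n * (1 / 2 ^ n - ?S) \<le> 2 ^ n * (8 * ?E (\<lambda>v. of_bool (\<forall>k. ?P k (v $ k))))"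
    by (rule mult_left_mono) simp
  moreover have "2 ^ n * (1 / 2 ^ n - ?S) = 1 - 2 ^ n * ?S" by (simp add: right_diff_distrib)
  ultimately have "1 / 2 \<le> 2 ^ n * (8 * ?E (\<lambda>v. of_bool (\<forall>k. ?P k (v $ k))))"
    using far by linarith
  then have A: "1 / (16 * 2 ^ n) \<le> ?E (\<lambda>v. of_bool (\<forall>k. ?P k (v $ k)))"
    by (simp only: divide_le_eq) (simp only: mult_ac, simp)
  have "gibbs_mean N \<beta> \<alpha> B (\<lambda>v. of_bool (?bad v))
      \<le> ?E ?R / (1 / (16 * 2 ^ n) * exp (2 * ?J * (?m - \<eta>)))"
  proof (rule gibbs_mean_bad_le[OF blocks A])
    fix v :: "real ^ 3" assume "\<forall>k. ?P k (v $ k)"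
    then have "v $ 2 = 1" "2 * (?m - \<eta>) \<le> v $ 1 + v $ 3"
      by (auto simp: forall_3)
    have "2 * ?J * (?m - \<eta>) = ?J * (2 * (?m - \<eta>))" by (simp only: mult_ac)
    also have "\<dots> \<le> ?J * (v $ 1 + v $ 3)"
      using \<open>2 * (?m - \<eta>) \<le> v $ 1 + v $ 3\<close> J by (rule mult_left_mono)
    also have "\<dots> = coupling ?J v" using \<open>v $ 2 = 1\<close> by (simp add: coupling_def)
    finally show "2 * ?J * (?m - \<eta>) \<le> coupling ?J v" .
  next
    fix v :: "real ^ 3" assume v: "\<And>k. \<bar>v $ k\<bar> \<le> 1" and bad: "?bad v"
    show "exp (coupling ?J v) \<le> ?R v"
    proof (cases "v $ 1 \<notin> far_set \<beta> \<eta> \<and> v $ 3 \<notin> far_set \<beta> \<eta>")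
      case True
      then have "coupling ?J v \<le> 2 * ?J * ?q"
        using strong_field_coupling_bound[OF v J \<eta> \<epsilon>] bad by simp
      then show ?thesis by (simp add: add_increasing)
    next
      case False
      then have "1 \<le> ?far 1 v + ?far 3 v" by auto
      then have "exp (2 * ?J) * 1 \<le> exp (2 * ?J) * (?far 1 v + ?far 3 v)"
        by (rule mult_left_mono) simp
      moreover have "exp (coupling ?J v) \<le> exp (2 * ?J)" using coupling_le[OF v J] by simp
      ultimately show ?thesis using exp_ge_zero[of "2 * ?J * ?q"] by linarith
    qed
  qed auto
  also have "?E ?R = exp (2 * ?J) * ?S + exp (2 * ?J * ?q)"
    by (simp only: far_mean_def gibbs_mean_add gibbs_mean_cmult gibbs_mean_const)
  also have "(exp (2 * ?J) * ?S + exp (2 * ?J * ?q)) / (1 / (16 * 2 ^ n) * exp (2 * ?J * (?m - \<eta>))) =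
      16 * 2 ^ n * (exp (2 * ?J) * ?S / exp (2 * ?J * (?m - \<eta>)) +
        exp (2 * ?J * ?q) / exp (2 * ?J * (?m - \<eta>)))"
    by (simp only: add_divide_distrib[symmetric] divide_divide_eq_right) simp
  also have "exp (2 * ?J * ?q) / exp (2 * ?J * (?m - \<eta>)) = exp (- (2 * ?J * (?m - \<eta> - ?q)))"
    unfolding exp_diff[symmetric] right_diff_distrib by simp
  also have "exp (2 * ?J) * ?S / exp (2 * ?J * (?m - \<eta>)) \<le> exp (2 * ?J) * ?S / 1"
    using J \<eta> by (intro divide_left_mono) (auto intro!: mult_nonneg_nonneg add_nonneg_nonneg far_mean_nonneg)
  finally show ?thesis by simp
qed

text \<open>
  Exponential concentration of a decoupled block absorbs every factor whose exponent is small
  against the size of the block.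
\<close>

lemma far_mean_tendsto_0:
  assumes \<beta>: "\<beta> > 1" and \<eta>: "\<eta> > 0"
    and blocks: "\<forall>\<^sub>F N in F. three_blocks N (n N) (B N)"
    and size: "filterlim (\<lambda>N. real (card (B N k))) at_top F"
    and small: "((\<lambda>N. g N / card (B N k)) \<longlongrightarrow> 0) F"
  shows "((\<lambda>N. exp (g N) * far_mean N \<beta> (B N) \<eta> k) \<longlongrightarrow> 0) F"
proof -
  obtain K c :: real where Kc: "K > 0" "c > 0" "\<forall>N n B k. three_blocks N n B \<longrightarrow>
      gibbs_mean N \<beta> 0 B (\<lambda>v. of_bool (v $ k \<in> far_set \<beta> \<eta>)) \<le> K * exp (- c * card (B k))"
    using decoupled_far_le[OF \<beta> \<eta>] by (elim exE conjE) (rule that)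
  let ?x = "\<lambda>N. real (card (B N k))"
  have "((\<lambda>N. g N / ?x N - c) \<longlongrightarrow> 0 - c) F" by (intro tendsto_intros small)
  moreover have "\<forall>\<^sub>F N in F. g N / ?x N - c = (g N - c * ?x N) / ?x N"
    using size[THEN filterlim_at_top_dense[THEN iffD1], rule_format, of 0]
    by eventually_elim (simp add: field_simps)
  ultimately have "((\<lambda>N. (g N - c * ?x N) / ?x N) \<longlongrightarrow> 0 - c) F"
    by (simp only: tendsto_cong)
  then have "((\<lambda>N. K * exp (g N - c * ?x N)) \<longlongrightarrow> K * 0) F"
    using Kc(2) by (intro tendsto_mult_left exp_tendsto_0_of_ratio[OF size]) auto
  then have lim: "((\<lambda>N. K * exp (g N - c * ?x N)) \<longlongrightarrow> 0) F" by simp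
  have "\<forall>\<^sub>F N in F. exp (g N) * far_mean N \<beta> (B N) \<eta> k \<le> K * exp (g N - c * ?x N)"
    using blocks
  proof eventually_elim
    case (elim N)
    have "exp (g N) * far_mean N \<beta> (B N) \<eta> k \<le> exp (g N) * (K * exp (- c * ?x N))"
      using Kc(3) elim unfolding far_mean_def by (intro mult_left_mono) auto
    also have "\<dots> = K * exp (g N - c * ?x N)" by (simp add: exp_diff exp_minus field_simps)
    finally show ?case .
  qed
  then show ?thesis
    by (intro tendsto_sandwich[OF _ _ tendsto_const lim]) (simp_all add: far_mean_nonneg)
qed

text \<open>Any configuration of three block signs can be flipped to the all-positive one.\<close>

lemma decoupled_concentration:
  assumes \<beta>: "\<beta> > 1" and \<epsilon>: "\<epsilon> > 0"
    and blocks: "\<forall>\<^sub>F N in F. three_blocks N (n N) (B N)"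
    and size: "\<And>k. filterlim (\<lambda>N. real (card (B N k))) at_top F"
  shows "((\<lambda>N. gibbs_mean N \<beta> 0 (B N) (\<lambda>v. of_bool (\<forall>s\<in>set sign_vectors.
      \<epsilon> \<le> dist (s * v) (vector [m_star \<beta>, m_star \<beta>, m_star \<beta>])))) \<longlongrightarrow> 0) F"
proof -
  let ?m = "m_star \<beta>"
  let ?far = "\<lambda>N. far_mean N \<beta> (B N) (\<epsilon> / 3)"
  have "((\<lambda>N. exp 0 * ?far N k) \<longlongrightarrow> 0) F" for k
    by (rule far_mean_tendsto_0[OF \<beta> _ blocks size]) (use \<epsilon> in auto)
  then have far: "((\<lambda>N. ?far N k) \<longlongrightarrow> 0) F" for k by simp
  have lim: "((\<lambda>N. ?far N 1 + ?far N 2 + ?far N 3) \<longlongrightarrow> 0) F"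
    using tendsto_add[OF tendsto_add[OF far far] far, of 1 2 3] by simp
  have pointwise: "of_bool (\<forall>s\<in>set sign_vectors. \<epsilon> \<le> dist (s * v) (vector [?m, ?m, ?m]))
      \<le> (of_bool (v $ 1 \<in> far_set \<beta> (\<epsilon> / 3)) + of_bool (v $ 2 \<in> far_set \<beta> (\<epsilon> / 3))
        + of_bool (v $ 3 \<in> far_set \<beta> (\<epsilon> / 3)) :: real)"
    if v: "\<And>k. \<bar>v $ k\<bar> \<le> 1" for v
  proof (cases "\<forall>k. v $ k \<notin> far_set \<beta> (\<epsilon> / 3)")
    case True
    then have near: "\<bar>\<bar>v $ k\<bar> - ?m\<bar> < \<epsilon> / 3" for k using v by (intro near_m_star) auto
    obtain s where s: "s \<in> set sign_vectors" "\<forall>k. (s * v) $ k = \<bar>v $ k\<bar>"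
      using some_flip_positive[of v] by blast
    have "dist (s * v) (vector [?m, ?m, ?m]) < \<epsilon>"
      using dist_vector_3_le[of s v ?m ?m ?m] s(2) near[of 1] near[of 2] near[of 3] by simp
    then have "\<not> (\<forall>s\<in>set sign_vectors. \<epsilon> \<le> dist (s * v) (vector [?m, ?m, ?m]))"
      using s(1) by (meson not_le)
    then show ?thesis by (simp only: of_bool_eq) simp
  next
    case False
    then have "1 \<le> (of_bool (v $ 1 \<in> far_set \<beta> (\<epsilon> / 3)) + of_bool (v $ 2 \<in> far_set \<beta> (\<epsilon> / 3))
        + of_bool (v $ 3 \<in> far_set \<beta> (\<epsilon> / 3)) :: real)" by (auto simp: forall_3)
    then show ?thesis by (rule order_trans[rotated]) simp
  qed
  have "\<forall>\<^sub>F N in F. gibbs_mean N \<beta> 0 (B N) (\<lambda>v. of_bool (\<forall>s\<in>set sign_vectors.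
      \<epsilon> \<le> dist (s * v) (vector [?m, ?m, ?m]))) \<le> ?far N 1 + ?far N 2 + ?far N 3"
    using blocks
  proof eventually_elim
    case (elim N)
    show ?case
      unfolding far_mean_def gibbs_mean_add[symmetric]
      by (rule gibbs_mean_mono[OF elim]) (rule pointwise)
  qed
  then show ?thesis
    by (rule tendsto_sandwich[OF _ _ tendsto_const lim, rotated]) (simp add: gibbs_mean_nonneg)
qed

lemma weak_field_concentration:
  assumes \<beta>: "\<beta> > 1" and \<epsilon>: "\<epsilon> > 0"
    and blocks: "\<forall>\<^sub>F N in F. three_blocks N (n N) (B N)"
    and size: "\<And>k. filterlim (\<lambda>N. real (card (B N k))) at_top F"
    and J: "\<forall>\<^sub>F N in F. 0 \<le> strength (\<alpha> N) (B N)"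
    and J_small: "\<And>k. ((\<lambda>N. strength (\<alpha> N) (B N) / card (B N k)) \<longlongrightarrow> 0) F"
    and J_large: "filterlim (\<lambda>N. strength (\<alpha> N) (B N)) at_top F"
  shows "((\<lambda>N. gibbs_mean N \<beta> (\<alpha> N) (B N) (\<lambda>v. of_bool (\<forall>s\<in>set [1, -1].
      \<epsilon> \<le> dist (s * v) (vector [m_star \<beta>, m_star \<beta>, m_star \<beta>])))) \<longlongrightarrow> 0) F"
proof -
  let ?m = "m_star \<beta>" and ?J = "\<lambda>N. strength (\<alpha> N) (B N)"
  have m: "0 < ?m" "?m < 1" using m_star_bounds[OF \<beta>] by auto
  \<comment> \<open>small enough that the exponent \<open>2 J \<eta>\<close>, the most that opposed outer blocks can reach, stays
    below the exponent \<open>2 J (m\<^sup>* - \<eta>)\<^sup>2\<close> of three equal signs\<close>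
  define \<eta> where "\<eta> = min (\<epsilon> / 3) (?m\<^sup>2 / 4)"
  have "?m\<^sup>2 \<le> ?m" using m by (simp add: power2_eq_square mult_left_le)
  then have \<eta>: "0 < \<eta>" "3 * \<eta> \<le> \<epsilon>" "\<eta> \<le> ?m / 4" "\<eta> \<le> ?m\<^sup>2 / 4"
    using \<epsilon> m by (auto simp: \<eta>_def)
  have "(3 / 4 * ?m)\<^sup>2 \<le> (?m - \<eta>)\<^sup>2" using \<eta> m by (intro power_mono) auto
  then have "9 / 16 * ?m\<^sup>2 \<le> (?m - \<eta>)\<^sup>2" by (simp add: power_mult_distrib power2_eq_square)
  moreover have "0 < ?m\<^sup>2" using m by simp
  ultimately have gap: "\<eta> < (?m - \<eta>)\<^sup>2" using \<eta>(4) by linarith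
  let ?far = "\<lambda>N. far_mean N \<beta> (B N) \<eta>"
  have "((\<lambda>N. exp 0 * ?far N k) \<longlongrightarrow> 0) F" for k
    by (rule far_mean_tendsto_0[OF \<beta> _ blocks size]) (use \<eta> in auto)
  then have far: "((\<lambda>N. ?far N k) \<longlongrightarrow> 0) F" for k by simp
  have J_far: "((\<lambda>N. exp (2 * ?J N) * ?far N k) \<longlongrightarrow> 0) F" for k
    using tendsto_mult_left[OF J_small[of k], of 2]
    by (intro far_mean_tendsto_0[OF \<beta> \<eta>(1) blocks size]) simp
  have "((\<lambda>N. exp (- (2 * ?J N * ((?m - \<eta>)\<^sup>2 - \<eta>)))) \<longlongrightarrow> 0) F"
  proof (rule exp_tendsto_0_of_ratio[OF J_large])
    have "\<forall>\<^sub>F N in F. - (2 * ?J N * ((?m - \<eta>)\<^sup>2 - \<eta>)) / ?J N = - 2 * ((?m - \<eta>)\<^sup>2 - \<eta>)"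
      using J_large[THEN filterlim_at_top_dense[THEN iffD1], rule_format, of 0]
      by eventually_elim simp
    then show "((\<lambda>N. - (2 * ?J N * ((?m - \<eta>)\<^sup>2 - \<eta>)) / ?J N) \<longlongrightarrow> - 2 * ((?m - \<eta>)\<^sup>2 - \<eta>)) F"
      by (rule tendsto_eventually)
  qed (use gap in simp)
  then have "((\<lambda>N. 16 * ((exp (2 * ?J N) * ?far N 1 + exp (2 * ?J N) * ?far N 2
      + exp (2 * ?J N) * ?far N 3) + exp (- (2 * ?J N * ((?m - \<eta>)\<^sup>2 - \<eta>)))))
      \<longlongrightarrow> 16 * ((0 + 0 + 0) + 0)) F"
    by (intro tendsto_intros J_far)
  then have lim: "((\<lambda>N. 16 * (exp (2 * ?J N) * (?far N 1 + ?far N 2 + ?far N 3)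
      + exp (- (2 * ?J N * ((?m - \<eta>)\<^sup>2 - \<eta>))))) \<longlongrightarrow> 0) F"
    by (simp only: distrib_left add_0 mult_zero_right)
  have "((\<lambda>N. ?far N 1 + ?far N 2 + ?far N 3) \<longlongrightarrow> 0) F"
    using tendsto_add[OF tendsto_add[OF far far] far, of 1 2 3] by simp
  then have "\<forall>\<^sub>F N in F. ?far N 1 + ?far N 2 + ?far N 3 < 1 / 2"
    by (rule order_tendstoD(2)) simp
  with blocks J have "\<forall>\<^sub>F N in F. gibbs_mean N \<beta> (\<alpha> N) (B N) (\<lambda>v. of_bool (\<forall>s\<in>set [1, -1].
      \<epsilon> \<le> dist (s * v) (vector [?m, ?m, ?m])))
    \<le> 16 * (exp (2 * ?J N) * (?far N 1 + ?far N 2 + ?far N 3)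
      + exp (- (2 * ?J N * ((?m - \<eta>)\<^sup>2 - \<eta>))))"
  proof eventually_elim
    case (elim N)
    show ?case by (rule weak_field_bad_le[OF elim(1,2)]) (use \<eta> m elim(3) in auto)
  qed
  then show ?thesis
    by (rule tendsto_sandwich[OF _ _ tendsto_const lim, rotated]) (simp add: gibbs_mean_nonneg)
qed

lemma strong_field_concentration:
  assumes \<beta>: "\<beta> > 1" and \<epsilon>: "\<epsilon> > 0"
    and blocks: "\<forall>\<^sub>F N in F. three_blocks N (n N) (B N)"
    and n_top: "filterlim (\<lambda>N. real (n N)) at_top F"
    and size: "\<And>k. filterlim (\<lambda>N. real (card (B N k))) at_top F"
    and n_small: "\<And>k. k \<noteq> 2 \<Longrightarrow> ((\<lambda>N. n N / card (B N k)) \<longlongrightarrow> 0) F"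
    and J_small: "\<And>k. k \<noteq> 2 \<Longrightarrow> ((\<lambda>N. strength (\<alpha> N) (B N) / card (B N k)) \<longlongrightarrow> 0) F"
    and J: "\<forall>\<^sub>F N in F. 0 \<le> strength (\<alpha> N) (B N)"
    and J_large: "filterlim (\<lambda>N. strength (\<alpha> N) (B N) / n N) at_top F"
  shows "((\<lambda>N. gibbs_mean N \<beta> (\<alpha> N) (B N) (\<lambda>v. of_bool (\<forall>s\<in>set [1, -1].
      \<epsilon> \<le> dist (s * v) (vector [m_star \<beta>, 1, m_star \<beta>])))) \<longlongrightarrow> 0) F"
proof -
  let ?m = "m_star \<beta>" and ?J = "\<lambda>N. strength (\<alpha> N) (B N)"
  have m: "0 < ?m" "?m < 1" using m_star_bounds[OF \<beta>] by auto
  define e where "e = min \<epsilon> 1"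
  have e: "0 < e" "e \<le> \<epsilon>" "e \<le> 1" using \<epsilon> by (auto simp: e_def)
  \<comment> \<open>small enough that a middle magnetization below \<open>1 - e / 3\<close> costs more than the outer
    magnetizations can gain within distance \<open>\<eta>\<close> of \<open>m\<^sup>*\<close>\<close>
  define \<eta> where "\<eta> = e * ?m / 12"
  have "e * ?m \<le> ?m" "e * ?m \<le> e" "0 < e * ?m" using e m by (auto simp: mult_left_le mult_left_le_one_le)
  then have \<eta>: "0 < \<eta>" "3 * \<eta> \<le> e" "\<eta> \<le> ?m / 12" unfolding \<eta>_def by linarith+
  define \<delta> where "\<delta> = ?m - \<eta> - max \<eta> ((1 - e / 3) * (?m + \<eta>))"
  have "(1 - e / 3) * (?m + \<eta>) \<le> ?m + \<eta> - 4 * \<eta>"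
    using e \<eta> by (simp add: \<eta>_def algebra_simps)
  then have \<delta>: "0 < \<delta>" unfolding \<delta>_def using \<eta> m by linarith
  let ?far = "\<lambda>N. far_mean N \<beta> (B N) \<eta>"
  have pow: "2 ^ k = exp (real k * ln 2)" for k :: nat by (simp add: exp_of_nat_mult)
  have n_far: "((\<lambda>N. 2 ^ n N * ?far N k) \<longlongrightarrow> 0) F" if "k \<noteq> 2" for k
    unfolding pow using tendsto_mult_right[OF n_small[OF that], of "ln 2"]
    by (intro far_mean_tendsto_0[OF \<beta> \<eta>(1) blocks size]) simp
  have J_far: "((\<lambda>N. exp (n N * ln 2 + 2 * ?J N) * ?far N k) \<longlongrightarrow> 0) F" if "k \<noteq> 2" for k
    using tendsto_add[OF tendsto_mult_right[OF n_small[OF that], of "ln 2"]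
        tendsto_mult_left[OF J_small[OF that], of 2]]
    by (intro far_mean_tendsto_0[OF \<beta> \<eta>(1) blocks size]) (simp add: add_divide_distrib)
  have tail: "((\<lambda>N. exp (n N * ln 2 - 2 * ?J N * \<delta>)) \<longlongrightarrow> 0) F"
  proof -
    have "\<forall>\<^sub>F N in F. (ln 2 + 1) / (2 * \<delta>) \<le> ?J N / n N"
      using J_large by (simp add: filterlim_at_top)
    moreover have "\<forall>\<^sub>F N in F. 0 < real (n N)"
      using n_top[THEN filterlim_at_top_dense[THEN iffD1]] by blast
    ultimately have "\<forall>\<^sub>F N in F. n N * ln 2 - 2 * ?J N * \<delta> \<le> - real (n N)"
      by eventually_elim (use \<delta> in \<open>simp add: field_simps\<close>)
    moreover have "filterlim (\<lambda>N. - real (n N)) at_bot F"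
      using n_top by (simp add: filterlim_uminus_at_top)
    ultimately have "filterlim (\<lambda>N. n N * ln 2 - 2 * ?J N * \<delta>) at_bot F"
      by (rule filterlim_at_bot_mono[rotated])
    then show ?thesis by (rule filterlim_compose[OF exp_at_bot])
  qed
  have "((\<lambda>N. 16 * (exp (n N * ln 2 + 2 * ?J N) * ?far N 1 + exp (n N * ln 2 + 2 * ?J N) * ?far N 3
      + exp (n N * ln 2 - 2 * ?J N * \<delta>))) \<longlongrightarrow> 16 * (0 + 0 + 0)) F"
    by (intro tendsto_intros J_far tail) auto
  moreover have "16 * (exp (n N * ln 2 + 2 * ?J N) * ?far N 1 + exp (n N * ln 2 + 2 * ?J N) * ?far N 3
      + exp (n N * ln 2 - 2 * ?J N * \<delta>)) =
      16 * 2 ^ n N * (exp (2 * ?J N) * (?far N 1 + ?far N 3) + exp (- (2 * ?J N * \<delta>)))" for N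
    by (simp add: pow exp_add exp_diff exp_minus field_simps)
  ultimately have lim: "((\<lambda>N. 16 * 2 ^ n N *
      (exp (2 * ?J N) * (?far N 1 + ?far N 3) + exp (- (2 * ?J N * \<delta>)))) \<longlongrightarrow> 0) F"
    by simp
  have "((\<lambda>N. 2 ^ n N * ?far N 1 + 2 ^ n N * ?far N 3) \<longlongrightarrow> 0 + 0) F"
    by (intro tendsto_add n_far) auto
  then have "\<forall>\<^sub>F N in F. 2 ^ n N * ?far N 1 + 2 ^ n N * ?far N 3 < 1 / 2"
    by (rule order_tendstoD(2)) simp
  moreover have "\<forall>\<^sub>F N in F. 0 < real (n N)"
    using n_top[THEN filterlim_at_top_dense[THEN iffD1]] by blast
  ultimately have "\<forall>\<^sub>F N in F. gibbs_mean N \<beta> (\<alpha> N) (B N) (\<lambda>v. of_bool (\<forall>s\<in>set [1, -1].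
      \<epsilon> \<le> dist (s * v) (vector [?m, 1, ?m])))
    \<le> 16 * 2 ^ n N * (exp (2 * ?J N) * (?far N 1 + ?far N 3) + exp (- (2 * ?J N * \<delta>)))"
    using blocks J
  proof eventually_elim
    case (elim N)
    have "gibbs_mean N \<beta> (\<alpha> N) (B N) (\<lambda>v. of_bool (\<forall>s\<in>set [1, -1].
        \<epsilon> \<le> dist (s * v) (vector [?m, 1, ?m])))
      \<le> gibbs_mean N \<beta> (\<alpha> N) (B N) (\<lambda>v. of_bool (\<forall>s\<in>set [1, -1].
        e \<le> dist (s * v) (vector [?m, 1, ?m])))"
      by (rule gibbs_mean_mono[OF elim(3)]) (use e(2) in auto)
    also have "\<dots> \<le> 16 * 2 ^ n N *
        (exp (2 * ?J N) * (?far N 1 + ?far N 3) + exp (- (2 * ?J N * \<delta>)))"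
      unfolding \<delta>_def
      by (rule strong_field_bad_le[OF elim(3,4) \<beta>])
         (use elim(1,2) \<eta> m e in \<open>auto simp: distrib_left\<close>)
    finally show ?case .
  qed
  then show ?thesis
    by (rule tendsto_sandwich[OF _ _ tendsto_const lim, rotated]) (simp add: gibbs_mean_nonneg)
qed

section \<open>The three regimes\<close>

theorem theorem2p3:
  fixes b :: "nat \<Rightarrow> nat" and \<alpha> :: "nat \<Rightarrow> real" and B :: "nat \<Rightarrow> 3 \<Rightarrow> nat set" and \<beta> :: real
  assumes b_mono: "incseq b"
    and b_infinity: "filterlim b at_top sequentially"
    and b_small: "(\<lambda>N. real (b N) / real N) \<longlonglongrightarrow> 0"
    and blocks: "\<And>N. N \<in> admissible b \<Longrightarrow> three_blocks N (b N) (B N)"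
    and beta: "\<beta> > 1"
    and alpha_pos: "\<And>N. N \<in> admissible b \<Longrightarrow> \<alpha> N > 0"
    and alpha_mono: "antimono_on (admissible b) \<alpha>"
    and alpha_zero: "(\<alpha> \<longlongrightarrow> 0) (admissible_at_top b)"
  shows
    "(filterlim (\<lambda>N. \<alpha> N * sqrt (real N / real (b N))) at_top (admissible_at_top b) \<longrightarrow>
        converges_weakly (\<lambda>N. magnetization_law N \<beta> (\<alpha> N) (B N))
          (dirac_average [vector [m_star \<beta>, 1, m_star \<beta>],
                          vector [- m_star \<beta>, - 1, - m_star \<beta>]])
          (admissible_at_top b)) \<and>
     (((\<lambda>N. \<alpha> N * sqrt (real N / real (b N))) \<longlongrightarrow> 0) (admissible_at_top b) \<and>
      filterlim (\<lambda>N. \<alpha> N * sqrt (real (b N) * real N)) at_top (admissible_at_top b) \<longrightarrow>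
        converges_weakly (\<lambda>N. magnetization_law N \<beta> (\<alpha> N) (B N))
          (dirac_average [vector [m_star \<beta>, m_star \<beta>, m_star \<beta>],
                          vector [- m_star \<beta>, - m_star \<beta>, - m_star \<beta>]])
          (admissible_at_top b)) \<and>
     (((\<lambda>N. \<alpha> N * sqrt (real (b N) * real N)) \<longlongrightarrow> 0) (admissible_at_top b) \<longrightarrow>
        converges_weakly (\<lambda>N. magnetization_law N \<beta> (\<alpha> N) (B N))
          (dirac_average
             [vector [\<chi>\<^sub>1 * m_star \<beta>, \<chi>\<^sub>2 * m_star \<beta>, \<chi>\<^sub>3 * m_star \<beta>].
                \<chi>\<^sub>1 \<leftarrow> [-1, 1], \<chi>\<^sub>2 \<leftarrow> [-1, 1], \<chi>\<^sub>3 \<leftarrow> [-1, 1]])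
          (admissible_at_top b))"
proof -
  define F where "F = admissible_at_top b"
  define x where "x N = real (card (B N 1))" for N
  define J where "J N = strength (\<alpha> N) (B N)" for N
  let ?m = "m_star \<beta>"
  have F_le: "F \<le> sequentially" by (simp add: F_def admissible_at_top_def)
  have ev_blocks: "\<forall>\<^sub>F N in F. three_blocks N (b N) (B N)"
    and ev_\<alpha>: "\<forall>\<^sub>F N in F. 0 < \<alpha> N"
    by (simp_all add: F_def admissible_at_top_def eventually_inf_principal blocks alpha_pos)
  have b_real: "filterlim (\<lambda>N. real (b N)) at_top sequentially"
    by (rule filterlim_compose[OF filterlim_real_sequentially b_infinity])
  have b_top: "filterlim (\<lambda>N. real (b N)) at_top F"
    using b_real F_le by (rule filterlim_mono[OF _ order_refl])
  have b_N: "((\<lambda>N. real (b N) / real N) \<longlongrightarrow> 0) F"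
    using b_small F_le by (rule tendsto_mono[rotated])
  have N_top: "filterlim (\<lambda>N. real N) at_top F"
    using filterlim_real_sequentially F_le by (rule filterlim_mono[OF _ order_refl])
  have ev_size: "\<forall>\<^sub>F N in F. 0 < real (b N) \<and> real N \<le> 4 * x N \<and> 2 * x N \<le> real N \<and> 0 < real N"
  proof -
    have "\<forall>\<^sub>F N in F. real (b N) / real N < 1 / 2" using b_N by (rule order_tendstoD(2)) simp
    moreover have "\<forall>\<^sub>F N in F. 0 < real N" "\<forall>\<^sub>F N in F. 0 < real (b N)"
      using N_top[THEN filterlim_at_top_dense[THEN iffD1]]
        b_top[THEN filterlim_at_top_dense[THEN iffD1]] by blast+
    ultimately show ?thesis using ev_blocks
    proof eventually_elim
      case (elim N)
      then have "real (b N) \<le> real N / 2" by (simp add: divide_less_eq)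
      with elim three_blocksD(6)[OF elim(4)] show ?case unfolding x_def by linarith
    qed
  qed
  have x_top: "filterlim x at_top F"
  proof (rule filterlim_at_top_mono)
    show "filterlim (\<lambda>N. 1 / 4 * real N) at_top F"
      by (rule filterlim_tendsto_pos_mult_at_top[OF tendsto_const _ N_top]) simp
    show "\<forall>\<^sub>F N in F. 1 / 4 * real N \<le> x N" using ev_size by eventually_elim simp
  qed
  have b_x: "((\<lambda>N. real (b N) / x N) \<longlongrightarrow> 0) F"
  proof (rule tendsto_sandwich[OF _ _ tendsto_const])
    show "((\<lambda>N. 4 * (real (b N) / real N)) \<longlongrightarrow> 0) F"
      using tendsto_mult_left[OF b_N, of 4] by simp
    show "\<forall>\<^sub>F N in F. real (b N) / x N \<le> 4 * (real (b N) / real N)"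
      using ev_size
    proof eventually_elim
      case (elim N)
      have "real (b N) / x N \<le> real (b N) / (real N / 4)"
        using elim by (intro divide_left_mono) auto
      then show ?case by (simp add: mult.commute)
    qed
  qed (simp add: x_def)
  have J_eq: "\<forall>\<^sub>F N in F. J N = \<alpha> N * sqrt (x N * real (b N))"
    using ev_blocks by eventually_elim (simp add: J_def strength_def x_def three_blocksD(4))
  have J_nonneg: "\<forall>\<^sub>F N in F. 0 \<le> strength (\<alpha> N) (B N)"
    using ev_\<alpha> by eventually_elim (simp add: strength_def)
  have J_x: "((\<lambda>N. J N / x N) \<longlongrightarrow> 0) F"
  proof -
    have "((\<lambda>N. \<alpha> N * sqrt (real (b N) / x N)) \<longlongrightarrow> 0 * sqrt 0) F"
      using alpha_zero b_x by (intro tendsto_mult tendsto_real_sqrt) (simp_all add: F_def)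
    moreover have "\<forall>\<^sub>F N in F. \<alpha> N * sqrt (real (b N) / x N) = J N / x N"
      using J_eq ev_size
    proof eventually_elim
      case (elim N)
      then have "0 < x N" by linarith
      then have "sqrt (x N * real (b N)) / x N = sqrt (real (b N) / x N)"
        by (simp add: real_sqrt_mult real_sqrt_divide field_simps)
      then show ?case by (simp add: elim(1) flip: times_divide_eq_right)
    qed
    ultimately show ?thesis by (simp only: tendsto_cong mult_zero_left)
  qed
  \<comment> \<open>\<open>N / 4 \<le> |B\<^sub>1| \<le> N / 2\<close>, so \<open>J\<close> and the scale in the hypotheses differ by a factor of at most two.\<close>
  have J_bounds: "\<forall>\<^sub>F N in F.
      \<alpha> N * sqrt (real (b N) * real N) / 2 \<le> J N \<and> J N \<le> \<alpha> N * sqrt (real (b N) * real N)"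
    using J_eq ev_size ev_\<alpha>
  proof eventually_elim
    case (elim N)
    have "sqrt (real (b N) * real N) / 2 = sqrt (real (b N) * real N / 4)"
      by (simp add: real_sqrt_divide)
    also have "\<dots> \<le> sqrt (x N * real (b N))"
      using elim by (intro real_sqrt_le_mono) (simp add: field_simps)
    finally have "\<alpha> N * (sqrt (real (b N) * real N) / 2) \<le> J N"
      unfolding elim(1) using elim(3) by (intro mult_left_mono) auto
    moreover have "sqrt (x N * real (b N)) \<le> sqrt (real (b N) * real N)"
      using elim by (intro real_sqrt_le_mono) (simp add: mult.commute mult_right_mono)
    then have "J N \<le> \<alpha> N * sqrt (real (b N) * real N)"
      unfolding elim(1) using elim(3) by (intro mult_left_mono) auto
    ultimately show ?case by simp
  qed
  have J_b_bounds: "\<forall>\<^sub>F N in F. 1 / 2 * (\<alpha> N * sqrt (real N / real (b N))) \<le> J N / real (b N) \<and>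
      J N / real (b N) \<le> \<alpha> N * sqrt (real N / real (b N))"
    using J_bounds ev_size
  proof eventually_elim
    case (elim N)
    have "sqrt (real (b N) * real N) / real (b N) = sqrt (real N / real (b N))"
      using elim by (simp add: real_sqrt_mult real_sqrt_divide field_simps)
    then have eq: "\<alpha> N * sqrt (real N / real (b N)) = \<alpha> N * sqrt (real (b N) * real N) / real (b N)"
      by (simp flip: times_divide_eq_right)
    from elim show ?case
      unfolding eq
      using divide_right_mono[of "\<alpha> N * sqrt (real (b N) * real N) / 2" "J N" "real (b N)"]
        divide_right_mono[of "J N" "\<alpha> N * sqrt (real (b N) * real N)" "real (b N)"]
      by simp
  qed
  have card_eq: "\<forall>\<^sub>F N in F. real (card (B N k)) = (if k = 2 then real (b N) else x N)" for k
    using ev_blocks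
    by eventually_elim (use exhaust_3[of k] in \<open>auto simp: x_def three_blocksD(4,5)\<close>)
  have size: "filterlim (\<lambda>N. real (card (B N k))) at_top F" for k
    using b_top x_top by (subst filterlim_cong[OF refl refl card_eq]) (cases "k = 2"; simp)
  have b_small_card: "((\<lambda>N. real (b N) / real (card (B N k))) \<longlongrightarrow> 0) F" if "k \<noteq> 2" for k
  proof -
    have "\<forall>\<^sub>F N in F. real (b N) / real (card (B N k)) = real (b N) / x N"
      using card_eq[of k] by eventually_elim (simp add: that)
    then show ?thesis using b_x by (simp only: tendsto_cong)
  qed
  have J_small: "((\<lambda>N. strength (\<alpha> N) (B N) / real (card (B N k))) \<longlongrightarrow> 0) F" if "k \<noteq> 2" for k
  proof -
    have "\<forall>\<^sub>F N in F. strength (\<alpha> N) (B N) / real (card (B N k)) = J N / x N"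
      using card_eq[of k] by eventually_elim (simp add: that J_def)
    then show ?thesis using J_x by (simp only: tendsto_cong)
  qed

  \<comment> \<open>The interaction is invariant under the simultaneous flip of all spins.\<close>
  have flip_inv: "\<forall>\<^sub>F N in F. \<forall>s\<in>set [1, -1]. gibbs_mean N \<beta> (\<alpha> N) (B N) (\<lambda>v. f (s * v)) =
      gibbs_mean N \<beta> (\<alpha> N) (B N) f" for f
    using ev_blocks
  proof eventually_elim
    case (elim N)
    have "gibbs_mean N \<beta> (\<alpha> N) (B N) (\<lambda>v. f (- 1 * v)) = gibbs_mean N \<beta> (\<alpha> N) (B N) f"
      by (rule gibbs_mean_flip[OF elim]) (auto simp: coupling_def algebra_simps)
    then show ?case by simp
  qed
  have two_point: "converges_weakly (\<lambda>N. magnetization_law N \<beta> (\<alpha> N) (B N))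
      (dirac_average [p, - p]) F"
    if "\<And>\<epsilon>. \<epsilon> > 0 \<Longrightarrow> ((\<lambda>N. gibbs_mean N \<beta> (\<alpha> N) (B N)
      (\<lambda>v. of_bool (\<forall>s\<in>set [1, -1]. \<epsilon> \<le> dist (s * v) p))) \<longlongrightarrow> 0) F" for p
    unfolding converges_weakly_def
  proof (intro allI impI)
    fix f :: "real ^ 3 \<Rightarrow> real" assume f: "continuous_on UNIV f \<and> bounded (range f)"
    then have meas: "f \<in> borel_measurable borel" by (intro borel_measurable_continuous_onI) auto
    have "((\<lambda>N. gibbs_mean N \<beta> (\<alpha> N) (B N) f)
        \<longlongrightarrow> (\<Sum>s\<leftarrow>[1, -1]. f (s * p)) / length [1, -1 :: real ^ 3]) F"
      using f by (intro gibbs_mean_tendsto_orbit_average[OF ev_blocks _ _ _ _ flip_inv that]) auto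
    then show "((\<lambda>N. \<integral>v. f v \<partial>magnetization_law N \<beta> (\<alpha> N) (B N))
        \<longlongrightarrow> (\<integral>v. f v \<partial>dirac_average [p, - p])) F"
      by (simp add: integral_magnetization_law[OF meas] integral_dirac_average[OF _ meas])
  qed

  show ?thesis
    unfolding F_def[symmetric]
  proof (intro conjI impI)
    assume "filterlim (\<lambda>N. \<alpha> N * sqrt (real N / real (b N))) at_top F"
    then have "filterlim (\<lambda>N. 1 / 2 * (\<alpha> N * sqrt (real N / real (b N)))) at_top F"
      by (rule filterlim_tendsto_pos_mult_at_top[OF tendsto_const, rotated]) simp
    then have J_large: "filterlim (\<lambda>N. J N / real (b N)) at_top F"
      by (rule filterlim_at_top_mono) (use J_b_bounds in \<open>auto elim: eventually_mono\<close>)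
    have "converges_weakly (\<lambda>N. magnetization_law N \<beta> (\<alpha> N) (B N))
        (dirac_average [vector [?m, 1, ?m], - vector [?m, 1, ?m]]) F"
      using J_large[unfolded J_def]
      by (intro two_point strong_field_concentration[OF beta _ ev_blocks b_top size b_small_card
            J_small J_nonneg])
    also have "- vector [?m, 1, ?m] = (vector [- ?m, - 1, - ?m] :: real ^ 3)"
      by (simp add: vec_eq_iff forall_3)
    finally show "converges_weakly (\<lambda>N. magnetization_law N \<beta> (\<alpha> N) (B N))
        (dirac_average [vector [?m, 1, ?m], vector [- ?m, - 1, - ?m]]) F" .
  next
    assume asm: "((\<lambda>N. \<alpha> N * sqrt (real N / real (b N))) \<longlongrightarrow> 0) F \<and>
      filterlim (\<lambda>N. \<alpha> N * sqrt (real (b N) * real N)) at_top F"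
    have "filterlim (\<lambda>N. 1 / 2 * (\<alpha> N * sqrt (real (b N) * real N))) at_top F"
      using asm by (intro filterlim_tendsto_pos_mult_at_top[OF tendsto_const]) auto
    then have J_large: "filterlim J at_top F"
      by (rule filterlim_at_top_mono) (use J_bounds in \<open>auto elim!: eventually_mono\<close>)
    have "((\<lambda>N. J N / real (b N)) \<longlongrightarrow> 0) F"
    proof (rule tendsto_sandwich[OF _ _ tendsto_const])
      show "((\<lambda>N. \<alpha> N * sqrt (real N / real (b N))) \<longlongrightarrow> 0) F" using asm by simp
      show "\<forall>\<^sub>F N in F. J N / real (b N) \<le> \<alpha> N * sqrt (real N / real (b N))"
        using J_b_bounds by (auto elim!: eventually_mono)
      show "\<forall>\<^sub>F N in F. 0 \<le> J N / real (b N)"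
        using J_nonneg by eventually_elim (simp add: J_def)
    qed
    moreover have "\<forall>\<^sub>F N in F. strength (\<alpha> N) (B N) / real (card (B N 2)) = J N / real (b N)"
      using card_eq[of 2] by eventually_elim (simp add: J_def)
    ultimately have "((\<lambda>N. strength (\<alpha> N) (B N) / real (card (B N 2))) \<longlongrightarrow> 0) F"
      by (simp only: tendsto_cong)
    then have J_small_all: "((\<lambda>N. strength (\<alpha> N) (B N) / real (card (B N k))) \<longlongrightarrow> 0) F" for k
      using J_small[of k] by (cases "k = 2") auto
    have "converges_weakly (\<lambda>N. magnetization_law N \<beta> (\<alpha> N) (B N))
        (dirac_average [vector [?m, ?m, ?m], - vector [?m, ?m, ?m]]) F"
      using J_large[unfolded J_def]
      by (intro two_point weak_field_concentration[OF beta _ ev_blocks size J_nonneg J_small_all])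
    also have "- vector [?m, ?m, ?m] = (vector [- ?m, - ?m, - ?m] :: real ^ 3)"
      by (simp add: vec_eq_iff forall_3)
    finally show "converges_weakly (\<lambda>N. magnetization_law N \<beta> (\<alpha> N) (B N))
        (dirac_average [vector [?m, ?m, ?m], vector [- ?m, - ?m, - ?m]]) F" .
  next
    assume asm: "((\<lambda>N. \<alpha> N * sqrt (real (b N) * real N)) \<longlongrightarrow> 0) F"
    have J_0: "(J \<longlongrightarrow> 0) F"
    proof (rule tendsto_sandwich[OF _ _ tendsto_const asm])
      show "\<forall>\<^sub>F N in F. J N \<le> \<alpha> N * sqrt (real (b N) * real N)"
        using J_bounds by (auto elim!: eventually_mono)
      show "\<forall>\<^sub>F N in F. 0 \<le> J N" using J_nonneg by (simp add: J_def)
    qed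
    let ?p = "vector [?m, ?m, ?m] :: real ^ 3"
    let ?pts = "[vector [\<chi>\<^sub>1 * ?m, \<chi>\<^sub>2 * ?m, \<chi>\<^sub>3 * ?m].
        \<chi>\<^sub>1 \<leftarrow> [-1, 1], \<chi>\<^sub>2 \<leftarrow> [-1, 1], \<chi>\<^sub>3 \<leftarrow> [-1, 1]] :: (real ^ 3) list"
    have pts: "?pts = map (\<lambda>s. s * ?p) sign_vectors"
      by (simp add: sign_vectors_def times_vector_3)
    have ne: "sign_vectors \<noteq> []" by (simp add: sign_vectors_def)
    show "converges_weakly (\<lambda>N. magnetization_law N \<beta> (\<alpha> N) (B N)) (dirac_average ?pts) F"
      unfolding converges_weakly_def pts
    proof (intro allI impI)
      fix f :: "real ^ 3 \<Rightarrow> real" assume f: "continuous_on UNIV f \<and> bounded (range f)"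
      then have meas: "f \<in> borel_measurable borel" by (intro borel_measurable_continuous_onI) auto
      obtain M where M: "\<And>v. \<bar>f v\<bar> \<le> M" using f by (auto simp: bounded_iff)
      have inv: "\<forall>\<^sub>F N in F. \<forall>s\<in>set sign_vectors. gibbs_mean N \<beta> 0 (B N) (\<lambda>v. f (s * v)) =
          gibbs_mean N \<beta> 0 (B N) f"
        using ev_blocks
        by eventually_elim (intro ballI decoupled_flip sign_vectors_signs)
      have "((\<lambda>N. gibbs_mean N \<beta> 0 (B N) f)
          \<longlongrightarrow> (\<Sum>s\<leftarrow>sign_vectors. f (s * ?p)) / length sign_vectors) F"
        using f by (intro gibbs_mean_tendsto_orbit_average[OF ev_blocks _ _ ne
              sign_vectors_translate inv decoupled_concentration[OF beta _ ev_blocks size]]) auto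
      moreover have "((\<lambda>N. gibbs_mean N \<beta> (\<alpha> N) (B N) f - gibbs_mean N \<beta> 0 (B N) f) \<longlongrightarrow> 0) F"
      proof (rule Lim_null_comparison)
        show "\<forall>\<^sub>F N in F. norm (gibbs_mean N \<beta> (\<alpha> N) (B N) f - gibbs_mean N \<beta> 0 (B N) f)
            \<le> M * (exp (4 * J N) - 1)"
          using ev_blocks J_nonneg
          by eventually_elim (simp add: J_def gibbs_mean_close_to_decoupled M)
        have "((\<lambda>N. M * (exp (4 * J N) - 1)) \<longlongrightarrow> M * (exp (4 * 0) - 1)) F"
          by (intro tendsto_intros J_0)
        then show "((\<lambda>N. M * (exp (4 * J N) - 1)) \<longlongrightarrow> 0) F" by simp
      qed
      ultimately have "((\<lambda>N. gibbs_mean N \<beta> 0 (B N) f +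
          (gibbs_mean N \<beta> (\<alpha> N) (B N) f - gibbs_mean N \<beta> 0 (B N) f))
          \<longlongrightarrow> (\<Sum>s\<leftarrow>sign_vectors. f (s * ?p)) / length sign_vectors + 0) F"
        by (rule tendsto_add)
      then show "((\<lambda>N. \<integral>v. f v \<partial>magnetization_law N \<beta> (\<alpha> N) (B N))
          \<longlongrightarrow> (\<integral>v. f v \<partial>dirac_average (map (\<lambda>s. s * ?p) sign_vectors))) F"
        using ne
        by (simp add: integral_magnetization_law[OF meas] integral_dirac_average[OF _ meas] o_def)
    qed
  qed
qed

end
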